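(* Consider $f(x)=\frac1n\sum_{i=1}^n f_i(x)$, $x\in\mathbb{R}^d$. Assume there exists $f_*\in\mathbb{R}$ with $f(x)\ge f_*$ for all $x\in\mathbb{R}^d$; that $f_i$ is $L_i$-smooth for all $i\in\{1,\dots,n\}$, i.e. $\|\nabla f_i(x)-\nabla f_i(y)\|\le L_i\|x-y\|$ for all $x,y\in\mathbb{R}^d$; and that $f$ satisfies the Polyak–Łojasiewicz condition with parameter $\mu$, i.e. $\|\nabla f(x)\|^2\ge2\mu(f(x)-f(x^* ))$ for all $x\in\mathbb{R}^d$, where $x^*=\arg\min_{x\in\mathbb{R}^d}f(x)$. Put $L^2=\frac1n\sum_{i=1}^nL_i^2$ and $\Delta_0=f(x^0)-f(x^* )$. Let $\mathcal{Q}$ be a quantization operator with parameter $\omega$ and expected density $\zeta_{\mathcal Q}$, and let $p=\frac{\zeta_{\mathcal Q}}{d}$. If $$\gamma\le\min\left\{\frac{1}{L\left(1+\sqrt{\frac{2\omega}{n}\left(\frac{d}{\zeta_{\mathcal Q}}-1\right)}\right)},\frac{p}{2\mu}\right\},$$ then MARINA requires $$K=\mathcal{O}\left(\max\left\{\frac{d}{\zeta_{\mathcal Q}},\frac L\mu\left(1+\sqrt{\frac{\omega}{n}\left(\frac{d}{\zeta_{\mathcal Q}}-1\right)}\right)\right\}\log\frac{\Delta_0}{\varepsilon}\right)$$ iterations/communication rounds to achieve $\mathbf{E}[f(x^K)-f(x^* )]\le\varepsilon$, and the expected total communication cost per worker is $$\mathcal{O}\left(d+\max\left\{d,\frac L\mu\left(\zeta_{\mathcal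 Q}+\sqrt{\frac{\omega\zeta_{\mathcal Q}}{n}(d-\zeta_{\mathcal Q})}\right)\right\}\log\frac{\Delta_0}{\varepsilon}\right)$$ under an assumption that the communication cost is proportional to the number of non-zero components of transmitted vectors from workers to the server.
   Context: $\|\cdot\|$ is the Euclidean norm; $\|y\|_0$ is the number of non-zero components of $y\in\mathbb{R}^d$. Quantization operator: a stochastic mapping $\mathcal{Q}:\mathbb{R}^d\to\mathbb{R}^d$ for which there is $\omega>0$ with $\mathbf{E}[\mathcal{Q}(x)]=x$ and $\mathbf{E}[\|\mathcal{Q}(x)-x\|^2]\le\omega\|x\|^2$ for any $x\in\mathbb{R}^d$. Its expected density is $\zeta_{\mathcal Q}=\sup_{x\in\mathbb{R}^d}\mathbf{E}[\|\mathcal{Q}(x)\|_0]$. MARINA (a distributed method with $n$ workers, worker $i$ having access to $f_i$, and a server; input: starting point $x^0$, stepsize $\gamma$, probability $p\in(0,1]$, number of iterations $K$): initialize $g^0=\nabla f(x^0)$. For $k=0,\dots,K-1$: sample $c_k\sim\mathrm{Bernoulli}(p)$ and broadcast $g^k$ to all workers; each worker $i=1,\dots,n$ in parallel computes $x^{k+1}=x^k-\gamma g^k$ and sets $g_i^{k+1}=\nabla f_i(x^{k+1})$ if $c_k=1$, and $g_i^{k+1}=g^k+\mathcal{Q}(\nabla f_i(x^{k+1})-\nabla f_i(x^k))$ otherwise; then $g^{k+1}=\frac1n\sum_{i=1}^n g_i^{k+1}$. The point considered here is the last iterate $x^K$.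
   Formalization: The stepsize γ is also bounded below by θ times the stated minimum, θ∈(0,1], with the O-constants depending only on θ (for γ→0 the claimed bound on K is false); ε≤Δ_0 is assumed so that the logarithm is nonnegative, and the bound on K is rounded up to an integer. *)

theory Defs
  imports "HOL-Probability.Probability"
begin

text \<open>
  The constants hidden in the O-notation must not depend on the dimension \<open>d\<close>, so \<open>d\<close> has to be
  quantified inside the statement and cannot be a type.  The space \<open>\<real>\<^sup>d\<close> is therefore
  \<^term>\<open>topspace (Euclidean_space d)\<close>: the functions \<open>nat \<Rightarrow> real\<close> that vanish at all indices
  \<open>j \<ge> d\<close>; the coordinates are \<open>j < d\<close>.
\<close>

type_synonym vec = "nat \<Rightarrow> real"

abbreviation Rn :: "nat \<Rightarrow> vec set" where
  "Rn d \<equiv> topspace (Euclidean_space d)"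

definition borelR :: "nat \<Rightarrow> vec measure" where
  "borelR d = restrict_space borel (Rn d)"

definition enorm :: "nat \<Rightarrow> vec \<Rightarrow> real" where
  "enorm d x = L2_set x {..<d}"

definition edist :: "nat \<Rightarrow> vec \<Rightarrow> vec \<Rightarrow> real" where
  "edist d x y = enorm d (\<lambda>j. x j - y j)"

definition nnz :: "nat \<Rightarrow> vec \<Rightarrow> nat" where
  "nnz d x = card {j. j < d \<and> x j \<noteq> 0}"

text \<open>Total (Frechet) differentiability on \<open>\<real>\<^sup>d\<close>, with the derivative represented by the vector \<open>v\<close>.\<close>

definition has_gradient :: "nat \<Rightarrow> (vec \<Rightarrow> real) \<Rightarrow> vec \<Rightarrow> vec \<Rightarrow> bool" where
  "has_gradient d f v x \<longleftrightarrow> v \<in> Rn d \<and>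
     (\<forall>e>0. \<exists>\<delta>>0. \<forall>y\<in>Rn d. edist d y x < \<delta> \<longrightarrow>
        \<bar>f y - f x - (\<Sum>j<d. v j * (y j - x j))\<bar> \<le> e * edist d y x)"

definition grad :: "nat \<Rightarrow> (vec \<Rightarrow> real) \<Rightarrow> vec \<Rightarrow> vec" where
  "grad d f x = (THE v. has_gradient d f v x)"

definition smooth :: "nat \<Rightarrow> real \<Rightarrow> (vec \<Rightarrow> real) \<Rightarrow> bool" where
  "smooth d L f \<longleftrightarrow>
     (\<forall>x\<in>Rn d. \<exists>v. has_gradient d f v x) \<and>
     (\<forall>x\<in>Rn d. \<forall>y\<in>Rn d. edist d (grad d f x) (grad d f y) \<le> L * edist d x y)"

definition is_argmin :: "nat \<Rightarrow> (vec \<Rightarrow> real) \<Rightarrow> vec \<Rightarrow> bool" where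
  "is_argmin d f z \<longleftrightarrow> z \<in> Rn d \<and> (\<forall>x\<in>Rn d. f z \<le> f x)"

definition polyak_lojasiewicz :: "nat \<Rightarrow> real \<Rightarrow> (vec \<Rightarrow> real) \<Rightarrow> vec \<Rightarrow> bool" where
  "polyak_lojasiewicz d \<mu> f xstar \<longleftrightarrow>
     (\<forall>x\<in>Rn d. (enorm d (grad d f x))\<^sup>2 \<ge> 2 * \<mu> * (f x - f xstar))"

definition average :: "nat \<Rightarrow> (nat \<Rightarrow> real) \<Rightarrow> real" where
  "average n a = (\<Sum>i=1..n. a i) / real n"

text \<open>
  A stochastic mapping \<open>\<Q>\<close> on \<open>\<real>\<^sup>d\<close> is a Markov kernel: \<open>Q x\<close> is the distribution of \<open>\<Q>(x)\<close>.
  Integrability is required explicitly since the Bochner integral of a non-integrable function is 0.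
\<close>

definition quantization :: "nat \<Rightarrow> real \<Rightarrow> (vec \<Rightarrow> vec measure) \<Rightarrow> bool" where
  "quantization d \<omega> Q \<longleftrightarrow> \<omega> > 0 \<and> Q \<in> measurable (borelR d) (prob_algebra (borelR d)) \<and>
     (\<forall>x\<in>Rn d.
        (\<forall>j<d. integrable (Q x) (\<lambda>y. y j) \<and> (\<integral>y. y j \<partial>Q x) = x j) \<and>
        integrable (Q x) (\<lambda>y. (edist d y x)\<^sup>2) \<and>
        (\<integral>y. (edist d y x)\<^sup>2 \<partial>Q x) \<le> \<omega> * (enorm d x)\<^sup>2)"

text \<open>The supremum is over a set of reals bounded by \<open>d\<close>.\<close>

definition expected_density :: "nat \<Rightarrow> (vec \<Rightarrow> vec measure) \<Rightarrow> real" where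
  "expected_density d Q = (SUP x\<in>Rn d. \<integral>y. real (nnz d y) \<partial>Q x)"

text \<open>
  A state \<open>(x, g, m)\<close> of MARINA consists of the iterate \<open>x\<^sup>k\<close>, the estimator \<open>g\<^sup>k\<close>, and the
  family \<open>m i\<close> (\<open>i = 1, \<dots>, n\<close>) of the vectors that the workers have sent to the server in order
  to form \<open>g\<^sup>k\<close>: worker \<open>i\<close> sends its full gradient if the coin \<open>c\<close> shows 1, and only the
  quantized gradient difference otherwise (the server knows \<open>g\<^sup>k\<close>).  All applications of
  \<open>\<Q>\<close>, over all workers and iterations, and all coins use independent randomness; the product
  measure below and the kernel composition express this.
\<close>

type_synonym state = "vec \<times> vec \<times> (nat \<Rightarrow> vec)"

definition state_space :: "nat \<Rightarrow> nat \<Rightarrow> state measure" where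
  "state_space d n = borelR d \<Otimes>\<^sub>M borelR d \<Otimes>\<^sub>M (\<Pi>\<^sub>M i\<in>{1..n}. borelR d)"

definition marina_step ::
  "nat \<Rightarrow> nat \<Rightarrow> (nat \<Rightarrow> vec \<Rightarrow> real) \<Rightarrow> (vec \<Rightarrow> vec measure) \<Rightarrow> real \<Rightarrow> real \<Rightarrow> state \<Rightarrow> state measure"
  where
  "marina_step d n f Q \<gamma> p = (\<lambda>(x, g, _).
     let x' = (\<lambda>j. x j - \<gamma> * g j) in
     measure_pmf (bernoulli_pmf p) \<bind> (\<lambda>c.
       (\<Pi>\<^sub>M i\<in>{1..n}.
          if c then return (borelR d) (grad d (f i) x')
          else Q (\<lambda>j. grad d (f i) x' j - grad d (f i) x j)) \<bind> (\<lambda>m.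
       let gw = (\<lambda>i. if c then m i else (\<lambda>j. g j + m i j)) in
       return (state_space d n) (x', (\<lambda>j. average n (\<lambda>i. gw i j)), m))))"

primrec marina ::
  "nat \<Rightarrow> nat \<Rightarrow> (nat \<Rightarrow> vec \<Rightarrow> real) \<Rightarrow> (vec \<Rightarrow> vec measure) \<Rightarrow> real \<Rightarrow> real \<Rightarrow> vec \<Rightarrow> nat \<Rightarrow> state measure"
  where
  "marina d n f Q \<gamma> p x0 0 =
     return (state_space d n)
       (x0, grad d (\<lambda>x. average n (\<lambda>i. f i x)) x0, \<lambda>i\<in>{1..n}. grad d (f i) x0)"
| "marina d n f Q \<gamma> p x0 (Suc k) = marina d n f Q \<gamma> p x0 k \<bind> marina_step d n f Q \<gamma> p"

text \<open>
  The expected total communication cost of worker \<open>i\<close> in the initialization and the first \<open>K\<close>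
  iterations, where sending \<open>v\<close> costs \<open>\<parallel>v\<parallel>\<^sub>0\<close> (the unit of cost is one non-zero component).
\<close>

definition expected_comm_cost ::
  "nat \<Rightarrow> nat \<Rightarrow> (nat \<Rightarrow> vec \<Rightarrow> real) \<Rightarrow> (vec \<Rightarrow> vec measure) \<Rightarrow> real \<Rightarrow> real \<Rightarrow> vec \<Rightarrow> nat \<Rightarrow> nat \<Rightarrow> real"
  where
  "expected_comm_cost d n f Q \<gamma> p x0 K i =
     (\<Sum>k\<le>K. \<integral>(x, g, m). real (nnz d (m i)) \<partial>marina d n f Q \<gamma> p x0 k)"

end

theory Submission
  imports Defs
begin

text \<open>
  The potential \<open>\<Phi>\<^sub>k = f(x\<^sup>k) - f(x\<^sup>*) + (\<gamma>/p) \<parallel>g\<^sup>k - \<nabla>f(x\<^sup>k)\<parallel>\<^sup>2\<close> contracts in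
  expectation by the factor \<open>1 - \<gamma>\<mu>\<close> in every step.  The descent lemma bounds \<open>f(x\<^sup>k\<^sup>+\<^sup>1)\<close> by
  \<open>f(x\<^sup>k) - (\<gamma>/2) \<parallel>\<nabla>f(x\<^sup>k)\<parallel>\<^sup>2\<close> plus the estimator error \<open>(\<gamma>/2) \<parallel>g\<^sup>k - \<nabla>f(x\<^sup>k)\<parallel>\<^sup>2\<close> minus a multiple
  of \<open>\<parallel>g\<^sup>k\<parallel>\<^sup>2\<close>.  The error vanishes when the coin shows 1; otherwise it grows only by the variance
  of an average of \<open>n\<close> independent unbiased quantizations, which is at most
  \<open>(\<omega>/n) L\<^sup>2 \<gamma>\<^sup>2 \<parallel>g\<^sup>k\<parallel>\<^sup>2\<close> and is absorbed by the negative term for the given stepsize.  Initially the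
  error is 0, so \<open>K\<close> of order \<open>(\<gamma>\<mu>)\<^sup>-\<^sup>1 log (\<Delta>\<^sub>0/\<epsilon>)\<close> steps suffice.  With \<open>p = \<zeta>/d\<close> a message has
  expected cost at most \<open>p d + (1 - p) \<zeta> \<le> 2 \<zeta>\<close>.
\<close>

section \<open>Gradients and smoothness\<close>

lemma Rn_iff: "x \<in> Rn d \<longleftrightarrow> (\<forall>j\<ge>d. x j = 0)"
  by (simp add: topspace_Euclidean_space)

lemma enorm_power2: "(enorm d x)\<^sup>2 = (\<Sum>j<d. (x j)\<^sup>2)"
  by (simp add: enorm_def L2_set_def sum_nonneg)

lemma edist_power2: "(edist d x y)\<^sup>2 = (\<Sum>j<d. (x j - y j)\<^sup>2)"
  by (simp add: edist_def enorm_power2)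

lemma enorm_nonneg [simp]: "0 \<le> enorm d x"
  by (simp add: enorm_def)

lemma edist_nonneg [simp]: "0 \<le> edist d x y"
  by (simp add: edist_def)

lemma abs_coord_le_edist: "j < d \<Longrightarrow> \<bar>x j - y j\<bar> \<le> edist d x y"
  unfolding edist_def enorm_def using member_le_L2_set[of "{..<d}" j "\<lambda>j. \<bar>x j - y j\<bar>"]
  by (simp add: L2_set_def)

lemma abs_inner_le: "\<bar>\<Sum>j<d. x j * y j\<bar> \<le> enorm d x * enorm d y"
proof -
  have "\<bar>\<Sum>j<d. x j * y j\<bar> \<le> (\<Sum>j<d. \<bar>x j\<bar> * \<bar>y j\<bar>)"
    by (rule order_trans[OF sum_abs]) (simp add: abs_mult)
  also have "\<dots> \<le> enorm d x * enorm d y"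
    unfolding enorm_def by (rule L2_set_mult_ineq)
  finally show ?thesis .
qed

lemma edist_line: "edist d (\<lambda>j. x j + s * h j) (\<lambda>j. x j + t * h j) = \<bar>s - t\<bar> * enorm d h"
proof (rule power2_eq_imp_eq)
  have "(x j + s * h j - (x j + t * h j))\<^sup>2 = (s - t)\<^sup>2 * (h j)\<^sup>2" for j
    by (simp add: power2_eq_square algebra_simps)
  then show "(edist d (\<lambda>j. x j + s * h j) (\<lambda>j. x j + t * h j))\<^sup>2 = (\<bar>s - t\<bar> * enorm d h)\<^sup>2"
    by (simp add: edist_power2 power_mult_distrib enorm_power2 sum_distrib_left)
qed auto

section \<open>Averages over the workers\<close>

lemma average_mono:
  "(\<And>i. i \<in> {1..n} \<Longrightarrow> a i \<le> b i) \<Longrightarrow> average n a \<le> average n b"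
  unfolding average_def by (intro divide_right_mono sum_mono) auto

lemma average_cong:
  "(\<And>i. i \<in> {1..n} \<Longrightarrow> a i = b i) \<Longrightarrow> average n a = average n b"
  unfolding average_def by (intro arg_cong2[where f="(/)"] sum.cong) auto

lemma average_const: "1 \<le> n \<Longrightarrow> average n (\<lambda>_. c) = c"
  by (simp add: average_def)

lemma abs_average_le: "\<bar>average n a\<bar> \<le> average n (\<lambda>i. \<bar>a i\<bar>)"
  by (simp add: average_def divide_right_mono)

lemma average_diff: "average n (\<lambda>i. a i - b i) = average n a - average n b"
  by (simp add: average_def sum_subtractf diff_divide_distrib)

lemma average_cmult_right: "average n (\<lambda>i. a i * c) = average n a * c"
  by (simp add: average_def sum_distrib_right)

lemma average_sum: "average n (\<lambda>i. \<Sum>j\<in>A. h i j) = (\<Sum>j\<in>A. average n (\<lambda>i. h i j))"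
  unfolding average_def sum_divide_distrib[symmetric] by (subst sum.swap) simp

text \<open>Jensen's inequality for the square, obtained from Cauchy-Schwarz. For
  \<open>n = 0\<close> both sides are 0, because division by zero yields 0.\<close>

lemma average_power2_le: "(average n a)\<^sup>2 \<le> average n (\<lambda>i. (a i)\<^sup>2)"
proof (cases "n = 0")
  case False
  have "(average n a)\<^sup>2 \<le> ((\<Sum>i=1..n. (a i)\<^sup>2) * real n) / (real n)\<^sup>2"
    unfolding average_def power_divide
    using sum_squared_le_sum_of_squares[of a "{1..n}"] by (intro divide_right_mono) auto
  then show ?thesis using False by (simp add: average_def power2_eq_square)
qed (simp add: average_def)

text \<open>The remainder of the average is the average of the remainders, so for a given
  \<open>e\<close> the smallest of the workers' radii serves. \<open>1 \<le> n\<close> makes this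
  minimum exist and lets the average of a constant be that constant.\<close>

lemma has_gradient_average:
  assumes "1 \<le> n" and g: "\<And>i. i \<in> {1..n} \<Longrightarrow> has_gradient d (f i) (v i) x"
  shows "has_gradient d (\<lambda>x. average n (\<lambda>i. f i x)) (\<lambda>j. average n (\<lambda>i. v i j)) x"
  unfolding has_gradient_def
proof (intro conjI allI impI)
  have "v i j = 0" if "i \<in> {1..n}" "j \<ge> d" for i j
    using g[OF that(1)] that(2) by (auto simp: has_gradient_def Rn_iff)
  then show "(\<lambda>j. average n (\<lambda>i. v i j)) \<in> Rn d"
    by (auto simp: Rn_iff average_def)
next
  fix e :: real assume "0 < e"
  then have "\<forall>i\<in>{1..n}. \<exists>\<delta>>0. \<forall>y\<in>Rn d. edist d y x < \<delta> \<longrightarrow>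
        \<bar>f i y - f i x - (\<Sum>j<d. v i j * (y j - x j))\<bar> \<le> e * edist d y x"
    using g by (auto simp: has_gradient_def)
  then obtain \<delta> where \<delta>: "\<And>i. i \<in> {1..n} \<Longrightarrow> \<delta> i > 0"
    "\<And>i y. i \<in> {1..n} \<Longrightarrow> y \<in> Rn d \<Longrightarrow> edist d y x < \<delta> i \<Longrightarrow>
        \<bar>f i y - f i x - (\<Sum>j<d. v i j * (y j - x j))\<bar> \<le> e * edist d y x"
    by metis
  have ne: "{1..n} \<noteq> {}" using assms(1) by auto
  show "\<exists>\<delta>>0. \<forall>y\<in>Rn d. edist d y x < \<delta> \<longrightarrow>
     \<bar>average n (\<lambda>i. f i y) - average n (\<lambda>i. f i x)
       - (\<Sum>j<d. average n (\<lambda>i. v i j) * (y j - x j))\<bar> \<le> e * edist d y x"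
  proof (intro exI[of _ "Min (\<delta> ` {1..n})"] conjI ballI impI)
    show "0 < Min (\<delta> ` {1..n})" using \<delta>(1) ne by (subst Min_gr_iff) auto
    fix y assume y: "y \<in> Rn d" "edist d y x < Min (\<delta> ` {1..n})"
    have "average n (\<lambda>i. f i y) - average n (\<lambda>i. f i x)
       - (\<Sum>j<d. average n (\<lambda>i. v i j) * (y j - x j))
       = average n (\<lambda>i. f i y - f i x - (\<Sum>j<d. v i j * (y j - x j)))"
      by (simp add: average_diff average_sum average_cmult_right)
    also have "\<bar>\<dots>\<bar> \<le> average n (\<lambda>i. \<bar>f i y - f i x - (\<Sum>j<d. v i j * (y j - x j))\<bar>)"
      by (rule abs_average_le)
    also have "\<dots> \<le> average n (\<lambda>_. e * edist d y x)"
    proof (intro average_mono \<delta>(2) y(1))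
      fix i assume "i \<in> {1..n}"
      then have "Min (\<delta> ` {1..n}) \<le> \<delta> i" by (intro Min_le) auto
      then show "edist d y x < \<delta> i" using y(2) by linarith
    qed
    finally show "\<bar>average n (\<lambda>i. f i y) - average n (\<lambda>i. f i x)
       - (\<Sum>j<d. average n (\<lambda>i. v i j) * (y j - x j))\<bar> \<le> e * edist d y x"
      unfolding average_const[OF assms(1)] .
  qed
qed

text \<open>The chain rule along a line. It reduces gradients on \<open>Rn d\<close> to ordinary
  derivatives of real functions, on which uniqueness of the gradient and the descent inequality
  rest.\<close>

lemma has_gradient_line:
  assumes "has_gradient d f v (\<lambda>j. x j + t * h j)" "x \<in> Rn d" "h \<in> Rn d"
  shows "((\<lambda>s. f (\<lambda>j. x j + s * h j)) has_real_derivative (\<Sum>j<d. v j * h j)) (at t)"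
  unfolding has_field_derivative_def has_derivative_at_alt
proof (intro conjI allI impI bounded_linear_mult_right)
  fix e :: real assume "0 < e"
  \<comment> \<open>The summand 1 keeps \<open>c\<close> positive when \<open>h\<close> has norm 0,
    so that \<open>e / c\<close> and \<open>\<delta> / c\<close> are meaningful.\<close>
  define c where "c = enorm d h + 1"
  have c: "0 < c" "enorm d h \<le> c" unfolding c_def using enorm_nonneg[of d h] by linarith+
  obtain \<delta> where \<delta>: "\<delta> > 0" "\<And>y. y \<in> Rn d \<Longrightarrow> edist d y (\<lambda>j. x j + t * h j) < \<delta> \<Longrightarrow>
        \<bar>f y - f (\<lambda>j. x j + t * h j) - (\<Sum>j<d. v j * (y j - (x j + t * h j)))\<bar>
          \<le> (e / c) * edist d y (\<lambda>j. x j + t * h j)"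
    using assms(1) \<open>0 < e\<close> c(1) unfolding has_gradient_def by (meson divide_pos_pos)
  show "\<exists>\<delta>>0. \<forall>s. norm (s - t) < \<delta> \<longrightarrow>
      norm (f (\<lambda>j. x j + s * h j) - f (\<lambda>j. x j + t * h j) - (\<Sum>j<d. v j * h j) * (s - t))
        \<le> e * norm (s - t)"
  proof (intro exI[of _ "\<delta> / c"] conjI allI impI)
    fix s assume s: "norm (s - t) < \<delta> / c"
    have "\<bar>s - t\<bar> * enorm d h \<le> \<bar>s - t\<bar> * c" using c by (intro mult_left_mono) auto
    also have "\<dots> < \<delta>" using s c by (simp add: field_simps)
    finally have lt: "edist d (\<lambda>j. x j + s * h j) (\<lambda>j. x j + t * h j) < \<delta>" by (simp add: edist_line)
    have "(\<lambda>j. x j + s * h j) \<in> Rn d" using assms by (simp add: Rn_iff)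
    from \<delta>(2)[OF this lt]
    have "\<bar>f (\<lambda>j. x j + s * h j) - f (\<lambda>j. x j + t * h j)
         - (\<Sum>j<d. v j * ((x j + s * h j) - (x j + t * h j)))\<bar> \<le> e / c * (\<bar>s - t\<bar> * enorm d h)"
      by (simp add: edist_line)
    also have "(\<Sum>j<d. v j * ((x j + s * h j) - (x j + t * h j))) = (\<Sum>j<d. v j * h j) * (s - t)"
      by (simp add: sum_distrib_left sum_distrib_right sum_subtractf[symmetric] algebra_simps)
    also have "e / c * (\<bar>s - t\<bar> * enorm d h) \<le> e / c * (\<bar>s - t\<bar> * c)"
      using c \<open>0 < e\<close> by (intro mult_left_mono) auto
    finally show "norm (f (\<lambda>j. x j + s * h j) - f (\<lambda>j. x j + t * h j) - (\<Sum>j<d. v j * h j) * (s - t))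
        \<le> e * norm (s - t)" using c by simp
  qed (use \<delta> c in auto)
qed

text \<open>Both vectors give the derivative at 0 along the direction \<open>v - w\<close>, so this
  direction is orthogonal to itself; beyond index \<open>d\<close> both vectors vanish. Uniqueness
  is what gives the definite description in \<open>grad\<close> its meaning.\<close>

lemma has_gradient_unique:
  assumes "has_gradient d f v x" "has_gradient d f w x" "x \<in> Rn d"
  shows "v = w"
proof -
  define h where "h = (\<lambda>j. v j - w j)"
  have vw: "v \<in> Rn d" "w \<in> Rn d" using assms by (auto simp: has_gradient_def)
  then have h: "h \<in> Rn d" by (auto simp: h_def Rn_iff)
  have "((\<lambda>s. f (\<lambda>j. x j + s * h j)) has_real_derivative (\<Sum>j<d. v j * h j)) (at 0)"
    "((\<lambda>s. f (\<lambda>j. x j + s * h j)) has_real_derivative (\<Sum>j<d. w j * h j)) (at 0)"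
    using assms h by (auto intro!: has_gradient_line)
  then have "(\<Sum>j<d. v j * h j) = (\<Sum>j<d. w j * h j)" by (rule DERIV_unique)
  then have "(\<Sum>j<d. (h j)\<^sup>2) = 0"
    by (simp add: h_def power2_eq_square left_diff_distrib sum_subtractf)
  then have "\<forall>j<d. h j = 0" by (simp add: sum_nonneg_eq_0_iff)
  then show ?thesis using h by (auto simp: h_def Rn_iff fun_eq_iff) (metis not_le)
qed

lemma grad_eq: "has_gradient d f v x \<Longrightarrow> x \<in> Rn d \<Longrightarrow> grad d f x = v"
  unfolding grad_def by (blast intro: has_gradient_unique)

lemma smoothD:
  assumes "smooth d L f" "x \<in> Rn d"
  shows has_gradient_grad: "has_gradient d f (grad d f x) x"
    and grad_in_Rn: "grad d f x \<in> Rn d"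
proof -
  show "has_gradient d f (grad d f x) x"
    using assms grad_eq unfolding smooth_def by metis
  then show "grad d f x \<in> Rn d" by (simp add: has_gradient_def)
qed

lemma smooth_grad_lipschitz:
  "smooth d L f \<Longrightarrow> x \<in> Rn d \<Longrightarrow> y \<in> Rn d \<Longrightarrow> edist d (grad d f x) (grad d f y) \<le> L * edist d x y"
  by (simp add: smooth_def)

text \<open>Along the segment from \<open>x\<close> to \<open>y\<close> the difference of the two sides, as a function of the
  parameter, has nonpositive derivative.\<close>

lemma smooth_descent:
  assumes sm: "smooth d L f" and x: "x \<in> Rn d" and y: "y \<in> Rn d"
  shows "f y \<le> f x + (\<Sum>j<d. grad d f x j * (y j - x j)) + L / 2 * (edist d y x)\<^sup>2"
proof -
  define h where "h = (\<lambda>j. y j - x j)"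
  define z where "z = (\<lambda>t j. x j + t * h j)"
  have h: "h \<in> Rn d" using x y by (auto simp: h_def Rn_iff)
  have z: "z t \<in> Rn d" for t using x h by (auto simp: z_def Rn_iff)
  define \<phi> where "\<phi> t = f (z t) - t * (\<Sum>j<d. grad d f x j * h j) - L / 2 * t\<^sup>2 * (enorm d h)\<^sup>2" for t
  have "\<phi> 1 \<le> \<phi> 0"
  proof (rule DERIV_nonpos_imp_nonincreasing[of 0 1 \<phi>])
    fix t :: real assume t: "0 \<le> t" "t \<le> 1"
    have fz: "((\<lambda>t. f (z t)) has_real_derivative (\<Sum>j<d. grad d f (z t) j * h j)) (at t)"
      unfolding z_def using has_gradient_grad[OF sm z, of t] x h
      by (intro has_gradient_line) (simp_all add: z_def)
    have "(\<phi> has_real_derivative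
       ((\<Sum>j<d. grad d f (z t) j * h j) - (\<Sum>j<d. grad d f x j * h j) - L * t * (enorm d h)\<^sup>2)) (at t)"
      unfolding \<phi>_def by (rule derivative_eq_intros fz refl | simp)+
    moreover have "(\<Sum>j<d. grad d f (z t) j * h j) - (\<Sum>j<d. grad d f x j * h j) \<le> L * t * (enorm d h)\<^sup>2"
    proof -
      have "(\<Sum>j<d. grad d f (z t) j * h j) - (\<Sum>j<d. grad d f x j * h j)
          = (\<Sum>j<d. (grad d f (z t) j - grad d f x j) * h j)"
        by (simp add: left_diff_distrib sum_subtractf)
      also have "\<dots> \<le> edist d (grad d f (z t)) (grad d f x) * enorm d h"
        unfolding edist_def using abs_inner_le[of "\<lambda>j. grad d f (z t) j - grad d f x j" h d] by simp
      also have "\<dots> \<le> (L * edist d (z t) x) * enorm d h"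
        by (intro mult_right_mono smooth_grad_lipschitz[OF sm z x]) simp
      also have "edist d (z t) x = t * enorm d h"
        using edist_line[of d x t h 0] t by (simp add: z_def)
      finally show ?thesis by (simp add: power2_eq_square mult_ac)
    qed
    ultimately show "\<exists>c. (\<phi> has_real_derivative c) (at t) \<and> c \<le> 0" by force
  qed simp
  moreover have "z 1 = y" "z 0 = x" by (auto simp: z_def h_def)
  ultimately show ?thesis by (simp add: \<phi>_def h_def edist_def)
qed

text \<open>Jensen in each coordinate bounds the squared distance of the averaged gradients by the
  average of the squared distances. Hence the root mean square of the \<open>Li\<close> is a
  Lipschitz constant.\<close>

lemma smooth_average:
  assumes n: "1 \<le> n" and sm: "\<And>i. i \<in> {1..n} \<Longrightarrow> smooth d (Li i) (f i)"
  shows "smooth d (sqrt (average n (\<lambda>i. (Li i)\<^sup>2))) (\<lambda>x. average n (\<lambda>i. f i x))"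
    and grad_average: "\<And>x. x \<in> Rn d \<Longrightarrow>
      grad d (\<lambda>x. average n (\<lambda>i. f i x)) x = (\<lambda>j. average n (\<lambda>i. grad d (f i) x j))"
proof -
  have hg: "has_gradient d (\<lambda>x. average n (\<lambda>i. f i x)) (\<lambda>j. average n (\<lambda>i. grad d (f i) x j)) x"
    if "x \<in> Rn d" for x
    using n sm that by (intro has_gradient_average has_gradient_grad) auto
  show grad: "grad d (\<lambda>x. average n (\<lambda>i. f i x)) x = (\<lambda>j. average n (\<lambda>i. grad d (f i) x j))"
    if "x \<in> Rn d" for x
    using hg[OF that] that by (rule grad_eq)
  have "edist d (\<lambda>j. average n (\<lambda>i. grad d (f i) x j)) (\<lambda>j. average n (\<lambda>i. grad d (f i) y j))
      \<le> sqrt (average n (\<lambda>i. (Li i)\<^sup>2)) * edist d x y" if xy: "x \<in> Rn d" "y \<in> Rn d" for x y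
  proof -
    have av0: "0 \<le> average n (\<lambda>i. (Li i)\<^sup>2)" by (simp add: average_def sum_nonneg)
    have "(edist d (\<lambda>j. average n (\<lambda>i. grad d (f i) x j)) (\<lambda>j. average n (\<lambda>i. grad d (f i) y j)))\<^sup>2
        \<le> (\<Sum>j<d. average n (\<lambda>i. (grad d (f i) x j - grad d (f i) y j)\<^sup>2))"
      unfolding edist_power2 average_diff[symmetric] by (intro sum_mono average_power2_le)
    also have "\<dots> = average n (\<lambda>i. (edist d (grad d (f i) x) (grad d (f i) y))\<^sup>2)"
      by (simp add: edist_power2 average_sum)
    also have "\<dots> \<le> average n (\<lambda>i. (Li i)\<^sup>2 * (edist d x y)\<^sup>2)"
    proof (rule average_mono)
      fix i assume "i \<in> {1..n}"
      then have "edist d (grad d (f i) x) (grad d (f i) y) \<le> Li i * edist d x y"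
        using sm xy by (intro smooth_grad_lipschitz) auto
      from power_mono[OF this, of 2]
      show "(edist d (grad d (f i) x) (grad d (f i) y))\<^sup>2 \<le> (Li i)\<^sup>2 * (edist d x y)\<^sup>2"
        by (simp add: power_mult_distrib)
    qed
    also have "\<dots> = (sqrt (average n (\<lambda>i. (Li i)\<^sup>2)) * edist d x y)\<^sup>2"
      using av0 by (simp add: average_cmult_right power_mult_distrib)
    finally show ?thesis
      by (rule power2_le_imp_le) (use av0 in simp)
  qed
  then show "smooth d (sqrt (average n (\<lambda>i. (Li i)\<^sup>2))) (\<lambda>x. average n (\<lambda>i. f i x))"
    unfolding smooth_def using hg grad by auto
qed

section \<open>Continuity with respect to the product topology\<close>

lemma continuous_on_edist: "continuous_on A (\<lambda>y. edist d y x)"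
  unfolding edist_def enorm_def L2_set_def
  by (intro continuous_intros continuous_on_subset[OF continuous_on_product_coordinates]) auto

text \<open>Continuity refers to the product topology on \<open>nat \<Rightarrow> real\<close>,
  whereas the estimates use \<open>edist\<close>. The link is that \<open>edist\<close> is itself
  continuous there, so it tends to 0 at \<open>x\<close>. The constant \<open>c\<close> may depend
  on \<open>x\<close>, which makes the criterion applicable to differentiable functions.\<close>

lemma continuous_on_Rn_if_locally_lipschitz:
  fixes f :: "vec \<Rightarrow> real"
  assumes "\<And>x. x \<in> Rn d \<Longrightarrow> \<exists>\<delta>>0. \<exists>c. \<forall>y\<in>Rn d. edist d y x < \<delta> \<longrightarrow> \<bar>f y - f x\<bar> \<le> c * edist d y x"
  shows "continuous_on (Rn d) f"
  unfolding continuous_on_def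
proof
  fix x assume x: "x \<in> Rn d"
  obtain \<delta> c where \<delta>: "\<delta> > 0"
    "\<And>y. y \<in> Rn d \<Longrightarrow> edist d y x < \<delta> \<Longrightarrow> \<bar>f y - f x\<bar> \<le> c * edist d y x"
    using assms[OF x] by blast
  have "edist d x x = 0" by (simp add: edist_def enorm_def L2_set_def)
  then have lim: "((\<lambda>y. edist d y x) \<longlongrightarrow> 0) (at x within Rn d)"
    using continuous_on_edist[of "Rn d" d x] x unfolding continuous_on_def by metis
  have "eventually (\<lambda>y. y \<in> Rn d) (at x within Rn d)"
    by (auto simp: eventually_at_topological)
  with order_tendstoD(2)[OF lim \<delta>(1)]
  have "eventually (\<lambda>y. norm (f y - f x) \<le> c * edist d y x) (at x within Rn d)"
    by eventually_elim (use \<delta> in auto)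
  moreover have "((\<lambda>y. c * edist d y x) \<longlongrightarrow> 0) (at x within Rn d)"
    using tendsto_mult_left[OF lim, of c] by simp
  ultimately have "((\<lambda>y. f y - f x) \<longlongrightarrow> 0) (at x within Rn d)" by (rule Lim_null_comparison)
  then show "(f \<longlongrightarrow> f x) (at x within Rn d)" by (simp add: LIM_zero_iff)
qed

text \<open>Differentiability with tolerance 1, together with Cauchy-Schwarz for the linear part,
  bounds the increment near \<open>x\<close> by a multiple of the distance.\<close>

lemma smooth_continuous_on:
  assumes "smooth d L f" shows "continuous_on (Rn d) f"
proof (rule continuous_on_Rn_if_locally_lipschitz)
  fix x assume x: "x \<in> Rn d"
  let ?v = "grad d f x"
  from has_gradient_grad[OF assms x] obtain \<delta> where \<delta>: "\<delta> > 0"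
    "\<And>y. y \<in> Rn d \<Longrightarrow> edist d y x < \<delta> \<Longrightarrow>
       \<bar>f y - f x - (\<Sum>j<d. ?v j * (y j - x j))\<bar> \<le> 1 * edist d y x"
    unfolding has_gradient_def by (meson zero_less_one)
  have "\<bar>f y - f x\<bar> \<le> (1 + enorm d ?v) * edist d y x" if "y \<in> Rn d" "edist d y x < \<delta>" for y
    using \<delta>(2)[OF that] abs_inner_le[of ?v "\<lambda>j. y j - x j" d]
    unfolding edist_def[symmetric] by (auto simp: algebra_simps abs_if split: if_splits)
  then show "\<exists>\<delta>>0. \<exists>c. \<forall>y\<in>Rn d. edist d y x < \<delta> \<longrightarrow> \<bar>f y - f x\<bar> \<le> c * edist d y x"
    using \<delta>(1) by blast
qed

lemma smooth_grad_continuous_on: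
  assumes "smooth d L f" shows "continuous_on (Rn d) (\<lambda>x. grad d f x j)"
proof (cases "j < d")
  case True
  show ?thesis
  proof (rule continuous_on_Rn_if_locally_lipschitz, intro exI conjI ballI impI)
    fix x y assume "x \<in> Rn d" "y \<in> Rn d"
    with abs_coord_le_edist[OF True] smooth_grad_lipschitz[OF assms]
    show "\<bar>grad d f y j - grad d f x j\<bar> \<le> L * edist d y x" by (meson order_trans)
  \<comment> \<open>The Lipschitz bound on the gradient is global, so any radius would do; this
    fixes it to 1.\<close>
  qed (rule zero_less_one)
next
  case False
  then have "\<And>x. x \<in> Rn d \<Longrightarrow> grad d f x j = 0"
    using grad_in_Rn[OF assms] by (auto simp: Rn_iff)
  then show ?thesis using continuous_on_cong[of "Rn d" "Rn d" "\<lambda>x. grad d f x j" "\<lambda>_. 0"] by simp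
qed

section \<open>Measurability and independent sums\<close>

lemma space_borelR [simp]: "space (borelR d) = Rn d"
  by (simp add: borelR_def space_restrict_space)

text \<open>On a countable product the Borel sets are generated by the coordinates, so maps into
  \<open>borelR d\<close> can be checked one real coordinate at a time.\<close>

lemma measurable_borelR_iff:
  "g \<in> M \<rightarrow>\<^sub>M borelR d \<longleftrightarrow> (\<forall>x\<in>space M. g x \<in> Rn d) \<and> (\<forall>j. (\<lambda>x. g x j) \<in> borel_measurable M)"
proof -
  have "g \<in> M \<rightarrow>\<^sub>M borelR d \<longleftrightarrow> g \<in> space M \<rightarrow> Rn d \<and> g \<in> borel_measurable M"
    unfolding borelR_def measurable_restrict_space2_iff by auto
  also have "g \<in> borel_measurable M \<longleftrightarrow> (\<forall>j. (\<lambda>x. g x j) \<in> borel_measurable M)"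
    by (auto intro: measurable_coordinatewise_then_product measurable_product_then_coordinatewise)
  finally show ?thesis by auto
qed

lemma measurable_borelR_coord [measurable]: "(\<lambda>x. x j) \<in> borel_measurable (borelR d)"
  using measurable_borelR_iff[of "\<lambda>x. x" "borelR d" d] by simp

lemma measurable_coord_compose [measurable (raw)]:
  "g \<in> M \<rightarrow>\<^sub>M borelR d \<Longrightarrow> (\<lambda>x. g x j) \<in> borel_measurable M"
  by (simp add: measurable_borelR_iff)

lemma continuous_on_Rn_measurable:
  "continuous_on (Rn d) f \<Longrightarrow> f \<in> borel_measurable (borelR d)"
  unfolding borelR_def by (rule borel_measurable_continuous_on_restrict)

lemma smooth_measurable: "smooth d L f \<Longrightarrow> f \<in> borel_measurable (borelR d)"
  by (intro continuous_on_Rn_measurable smooth_continuous_on)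

lemma smooth_grad_measurable: "smooth d L f \<Longrightarrow> grad d f \<in> borelR d \<rightarrow>\<^sub>M borelR d"
  unfolding measurable_borelR_iff
  by (auto intro: grad_in_Rn continuous_on_Rn_measurable smooth_grad_continuous_on)

lemma nnz_eq_sum: "real (nnz d y) = (\<Sum>j<d. if y j \<noteq> 0 then 1 else 0)"
proof -
  have "{j. j < d \<and> y j \<noteq> 0} = {..<d} \<inter> {j. y j \<noteq> 0}" by auto
  then show ?thesis by (simp add: nnz_def sum.If_cases)
qed

lemma nnz_measurable [measurable]: "(\<lambda>y. real (nnz d y)) \<in> borel_measurable (borelR d)"
  unfolding nnz_eq_sum by measurable

lemma nnz_le: "nnz d y \<le> d"
  unfolding nnz_def using card_mono[of "{..<d}" "{j. j < d \<and> y j \<noteq> 0}"] by auto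

text \<open>For a finite index set the boxes form an intersection-stable generator, and the measure
  of a box is a finite product of functions measurable in the parameter. This makes the joint law of
  all workers' messages a kernel in the current state.\<close>

lemma measurable_PiM_prob_kernel:
  assumes I: "finite I" and K: "\<And>i. i \<in> I \<Longrightarrow> K i \<in> M \<rightarrow>\<^sub>M prob_algebra (N i)"
  shows "(\<lambda>x. \<Pi>\<^sub>M i\<in>I. K i x) \<in> M \<rightarrow>\<^sub>M prob_algebra (\<Pi>\<^sub>M i\<in>I. N i)"
proof -
  have Kx: "prob_space (K i x)" "sets (K i x) = sets (N i)" if "i \<in> I" "x \<in> space M" for i x
    using measurable_space[OF K[OF that(1)] that(2)] by (auto simp: space_prob_algebra)
  let ?G = "{(\<Pi>\<^sub>E i\<in>I. X i) |X. \<forall>i\<in>I. X i \<in> sets (N i)}"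
  have alg: "prod_algebra I N = ?G"
    unfolding prod_algebra_eq_finite[OF I] by (auto simp: Pi_iff)
  show ?thesis
  proof (rule measurable_prob_algebra_generated)
    show "sets (PiM I N) = sigma_sets (\<Pi>\<^sub>E i\<in>I. space (N i)) ?G"
      by (simp add: sets_PiM alg)
    show "Int_stable ?G" by (rule Int_stable_PiE)
    show "?G \<subseteq> Pow (\<Pi>\<^sub>E i\<in>I. space (N i))"
      using prod_algebra_sets_into_space[of I N] by (simp add: alg)
    fix x assume x: "x \<in> space M"
    show "prob_space (\<Pi>\<^sub>M i\<in>I. K i x)" by (rule prob_space_PiM) (rule Kx[OF _ x])
    show "sets (\<Pi>\<^sub>M i\<in>I. K i x) = sets (PiM I N)" by (rule sets_PiM_cong) (auto simp: Kx x)
  next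
    fix A assume "A \<in> ?G"
    then obtain X where X: "A = (\<Pi>\<^sub>E i\<in>I. X i)" "\<And>i. i \<in> I \<Longrightarrow> X i \<in> sets (N i)" by auto
    have "emeasure (\<Pi>\<^sub>M i\<in>I. K i x) A = (\<Prod>i\<in>I. emeasure (K i x) (X i))" if x: "x \<in> space M" for x
    proof -
      have "A = prod_emb I (\<lambda>i. K i x) I (\<Pi>\<^sub>E i\<in>I. X i)"
        unfolding X(1) using X(2) Kx(2)[OF _ x]
        by (intro prod_emb_PiE_same_index[symmetric] sets.sets_into_space) simp
      then show ?thesis
        using emeasure_PiM_emb[of I "\<lambda>i. K i x" I X] Kx x I X(2) by auto
    qed
    moreover have "(\<lambda>x. \<Prod>i\<in>I. emeasure (K i x) (X i)) \<in> borel_measurable M"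
      using X(2) K
      by (intro borel_measurable_prod_ennreal measurable_emeasure_kernel[OF measurable_prob_algebraD])
    ultimately show "(\<lambda>x. emeasure (\<Pi>\<^sub>M i\<in>I. K i x) A) \<in> borel_measurable M"
      by (subst measurable_cong) auto
  qed
qed

lemma integral_PiM_component:
  fixes h :: "'a \<Rightarrow> real"
  assumes M: "\<And>i. i \<in> I \<Longrightarrow> prob_space (M i)" and i: "i \<in> I" and h: "integrable (M i) h"
  shows integrable_PiM_component: "integrable (PiM I M) (\<lambda>m. h (m i))"
    and "(\<integral>m. h (m i) \<partial>PiM I M) = (\<integral>y. h y \<partial>M i)"
proof -
  have d: "distr (PiM I M) (M i) (\<lambda>m. m i) = M i" using M i by (rule distr_PiM_component)
  have m: "(\<lambda>m. m i) \<in> PiM I M \<rightarrow>\<^sub>M M i" using i by measurable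
  show "integrable (PiM I M) (\<lambda>m. h (m i))"
    using integrable_distr[OF m, of h] h by (simp add: d)
  show "(\<integral>m. h (m i) \<partial>PiM I M) = (\<integral>y. h y \<partial>M i)"
    using integral_distr[OF m, of h] h by (simp add: d borel_measurable_integrable)
qed

text \<open>Independence of two distinct coordinates: Fubini for finite products, with the integrand
  1 at all other indices.\<close>

lemma integral_PiM_mult:
  fixes g h :: "'a \<Rightarrow> real"
  assumes I: "finite I" and M: "\<And>i. i \<in> I \<Longrightarrow> prob_space (M i)"
    and ik: "i \<in> I" "k \<in> I" "i \<noteq> k" and g: "integrable (M i) g" and h: "integrable (M k) h"
  shows integrable_PiM_mult: "integrable (PiM I M) (\<lambda>m. g (m i) * h (m k))"
    and "(\<integral>m. g (m i) * h (m k) \<partial>PiM I M) = (\<integral>y. g y \<partial>M i) * (\<integral>y. h y \<partial>M k)"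
proof -
  \<comment> \<open>\<open>product_sigma_finite\<close> concerns every index of the type, so an
    arbitrary point mass is placed outside \<open>I\<close>; the product over \<open>I\<close> does
    not change.\<close>
  define M' where "M' l = (if l \<in> I then M l else return (count_space UNIV) undefined)" for l
  have M': "prob_space (M' l)" for l using M by (auto simp: M'_def prob_space_return)
  then interpret product_sigma_finite M'
    by (auto simp: product_sigma_finite_def prob_space_imp_sigma_finite)
  have PiM_eq: "PiM I M' = PiM I M" by (rule PiM_cong) (auto simp: M'_def)
  define u where "u l = (if l = i then g else if l = k then h else (\<lambda>_. 1))" for l
  have u: "integrable (M' l) (u l)" if "l \<in> I" for l
  proof -
    interpret prob_space "M' l" by (rule M')
    have "integrable (M' l) (\<lambda>_. 1 :: real)" by simp
    then show ?thesis using g h ik that by (auto simp: u_def M'_def)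
  qed
  have prod: "(\<Prod>l\<in>I. c l) = c i * c k" if "\<And>l. l \<in> I \<Longrightarrow> l \<noteq> i \<Longrightarrow> l \<noteq> k \<Longrightarrow> c l = 1"
    for c :: "_ \<Rightarrow> real"
  proof -
    have "(\<Prod>l\<in>I. c l) = (\<Prod>l\<in>{i,k}. c l)" using that ik I by (intro prod.mono_neutral_right) auto
    then show ?thesis using ik by simp
  qed
  have eq: "(\<Prod>l\<in>I. u l (m l)) = g (m i) * h (m k)" for m
    by (subst prod) (use ik in \<open>auto simp: u_def\<close>)
  show "integrable (PiM I M) (\<lambda>m. g (m i) * h (m k))"
    using product_integrable_prod[OF I u] by (simp add: eq PiM_eq)
  have "(\<integral>m. g (m i) * h (m k) \<partial>PiM I M) = (\<Prod>l\<in>I. integral\<^sup>L (M' l) (u l))"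
    using product_integral_prod[OF I u] by (simp add: eq PiM_eq)
  also have "\<dots> = integral\<^sup>L (M' i) (u i) * integral\<^sup>L (M' k) (u k)"
    by (rule prod) (auto simp: u_def prob_space.prob_space[OF M'])
  finally show "(\<integral>m. g (m i) * h (m k) \<partial>PiM I M) = (\<integral>y. g y \<partial>M i) * (\<integral>y. h y \<partial>M k)"
    using ik by (simp add: u_def M'_def)
qed

text \<open>After expanding the square, the linear terms vanish by centering and the off-diagonal
  products by independence, so the variances add. This is the source of the gain
  \<open>1 / n\<close> from averaging over the workers.\<close>

lemma integral_PiM_sum_power2:
  fixes X :: "'i \<Rightarrow> 'a \<Rightarrow> real"
  assumes I: "finite I" and M: "\<And>i. i \<in> I \<Longrightarrow> prob_space (M i)"
    and X: "\<And>i. i \<in> I \<Longrightarrow> integrable (M i) (X i)"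
    and X2: "\<And>i. i \<in> I \<Longrightarrow> integrable (M i) (\<lambda>y. (X i y)\<^sup>2)"
    and X0: "\<And>i. i \<in> I \<Longrightarrow> (\<integral>y. X i y \<partial>M i) = 0"
  shows integrable_PiM_sum_power2: "integrable (PiM I M) (\<lambda>m. (a + (\<Sum>i\<in>I. X i (m i)))\<^sup>2)"
    and "(\<integral>m. (a + (\<Sum>i\<in>I. X i (m i)))\<^sup>2 \<partial>PiM I M) = a\<^sup>2 + (\<Sum>i\<in>I. \<integral>y. (X i y)\<^sup>2 \<partial>M i)"
proof -
  interpret P: prob_space "PiM I M" by (rule prob_space_PiM) (rule M)
  have expand: "(a + (\<Sum>i\<in>I. X i (m i)))\<^sup>2
    = a\<^sup>2 + (\<Sum>i\<in>I. 2 * a * X i (m i)) + (\<Sum>i\<in>I. \<Sum>k\<in>I. X i (m i) * X k (m k))" for m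
  proof -
    have "(a + s)\<^sup>2 = a\<^sup>2 + 2 * a * s + s * s" for s :: real
      by (simp add: power2_eq_square algebra_simps)
    then show ?thesis unfolding sum_product[symmetric] by (simp add: sum_distrib_left)
  qed
  have int2: "integrable (PiM I M) (\<lambda>m. X i (m i) * X k (m k))"
    "(\<integral>m. X i (m i) * X k (m k) \<partial>PiM I M) = (if i = k then \<integral>y. (X i y)\<^sup>2 \<partial>M i else 0)"
    if "i \<in> I" "k \<in> I" for i k
  proof -
    show "integrable (PiM I M) (\<lambda>m. X i (m i) * X k (m k))"
      using integrable_PiM_mult[OF I M that _ X X] integrable_PiM_component[OF M _ X2] that
      by (cases "i = k") (auto simp: power2_eq_square)
    show "(\<integral>m. X i (m i) * X k (m k) \<partial>PiM I M) = (if i = k then \<integral>y. (X i y)\<^sup>2 \<partial>M i else 0)"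
      using integral_PiM_mult(2)[OF I M that _ X X] integral_PiM_component(2)[OF M _ X2] that X0
      by (cases "i = k") (auto simp: power2_eq_square)
  qed
  have int1: "integrable (PiM I M) (\<lambda>m. X i (m i))" "(\<integral>m. X i (m i) \<partial>PiM I M) = 0" if "i \<in> I" for i
    using integrable_PiM_component[OF M that X] integral_PiM_component(2)[OF M that X] that X0 by auto
  have const: "has_bochner_integral (PiM I M) (\<lambda>_. a\<^sup>2) (a\<^sup>2)"
    by (simp add: has_bochner_integral_iff P.prob_space)
  have lin: "has_bochner_integral (PiM I M) (\<lambda>m. 2 * a * X i (m i)) (2 * a * 0)" if "i \<in> I" for i
    using int1[OF that] by (intro has_bochner_integral_mult_right) (simp add: has_bochner_integral_iff)
  have quad: "has_bochner_integral (PiM I M) (\<lambda>m. X i (m i) * X k (m k))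
      (if i = k then \<integral>y. (X i y)\<^sup>2 \<partial>M i else 0)" if "i \<in> I" "k \<in> I" for i k
    using int2[OF that] by (simp only: has_bochner_integral_iff)
  have "has_bochner_integral (PiM I M) (\<lambda>m. (a + (\<Sum>i\<in>I. X i (m i)))\<^sup>2)
      (a\<^sup>2 + (\<Sum>i\<in>I. 2 * a * 0) + (\<Sum>i\<in>I. \<Sum>k\<in>I. if i = k then \<integral>y. (X i y)\<^sup>2 \<partial>M i else 0))"
    unfolding expand by (intro has_bochner_integral_add has_bochner_integral_sum const lin quad)
  then show "integrable (PiM I M) (\<lambda>m. (a + (\<Sum>i\<in>I. X i (m i)))\<^sup>2)"
    "(\<integral>m. (a + (\<Sum>i\<in>I. X i (m i)))\<^sup>2 \<partial>PiM I M) = a\<^sup>2 + (\<Sum>i\<in>I. \<integral>y. (X i y)\<^sup>2 \<partial>M i)"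
    using I by (auto simp: has_bochner_integral_iff sum.delta')
qed

section \<open>The MARINA Markov kernel\<close>

locale quantizer =
  fixes d :: nat and \<omega> :: real and Q :: "vec \<Rightarrow> vec measure"
  assumes quant: "quantization d \<omega> Q"
begin

lemma measurable_Q [measurable]: "Q \<in> borelR d \<rightarrow>\<^sub>M prob_algebra (borelR d)"
  using quant by (simp add: quantization_def)

lemma quantizationD:
  assumes "x \<in> Rn d"
  shows prob_space_Q: "prob_space (Q x)" and sets_Q: "sets (Q x) = sets (borelR d)"
    and integrable_Q_coord: "j < d \<Longrightarrow> integrable (Q x) (\<lambda>y. y j)"
    and integral_Q_coord: "j < d \<Longrightarrow> (\<integral>y. y j \<partial>Q x) = x j"
    and integrable_Q_edist: "integrable (Q x) (\<lambda>y. (edist d y x)\<^sup>2)"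
    and integral_Q_edist: "(\<integral>y. (edist d y x)\<^sup>2 \<partial>Q x) \<le> \<omega> * (enorm d x)\<^sup>2"
proof -
  from measurable_space[OF measurable_Q, of x] assms
  show "prob_space (Q x)" "sets (Q x) = sets (borelR d)" by (auto simp: space_prob_algebra)
qed (use quant assms in \<open>auto simp: quantization_def\<close>)

text \<open>The bound \<open>nnz d y \<le> d\<close> gives integrability and bounds the set under
  the supremum; the point \<open>x\<close> shows that this set is nonempty.\<close>

lemma nnz_Q_le_expected_density:
  assumes "x \<in> Rn d"
  shows integrable_Q_nnz: "integrable (Q x) (\<lambda>y. real (nnz d y))"
    and "(\<integral>y. real (nnz d y) \<partial>Q x) \<le> expected_density d Q"
    and expected_density_le: "expected_density d Q \<le> real d"
proof -
  have int: "integrable (Q x) (\<lambda>y. real (nnz d y))" "(\<integral>y. real (nnz d y) \<partial>Q x) \<le> real d"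
    if "x \<in> Rn d" for x
  proof -
    interpret prob_space "Q x" using that by (rule prob_space_Q)
    have "(\<lambda>y. real (nnz d y)) \<in> borel_measurable (Q x)"
      using nnz_measurable measurable_cong_sets[OF sets_Q[OF that] refl] by blast
    then show i: "integrable (Q x) (\<lambda>y. real (nnz d y))"
      by (intro integrable_const_bound[of _ "real d"]) (auto simp: nnz_le)
    show "(\<integral>y. real (nnz d y) \<partial>Q x) \<le> real d"
      by (intro integral_le_const i) (auto simp: nnz_le)
  qed
  show "integrable (Q x) (\<lambda>y. real (nnz d y))" using assms by (rule int)
  show "(\<integral>y. real (nnz d y) \<partial>Q x) \<le> expected_density d Q"
    unfolding expected_density_def using assms int(2) by (intro cSUP_upper bdd_aboveI2) auto
  show "expected_density d Q \<le> real d"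
    unfolding expected_density_def using assms int(2) by (intro cSUP_least) auto
qed

text \<open>If the density were 0, the quantization of the first unit vector would vanish almost
  surely, contradicting unbiasedness. Hence \<open>\<zeta> / d\<close> is a positive coin
  probability.\<close>

lemma expected_density_pos:
  assumes d: "1 \<le> d" shows "0 < expected_density d Q"
proof -
  define x :: vec where "x = (\<lambda>j. if j = 0 then 1 else 0)"
  have x: "x \<in> Rn d" using d by (auto simp: x_def Rn_iff)
  interpret prob_space "Q x" using x by (rule prob_space_Q)
  have "0 < (\<integral>y. real (nnz d y) \<partial>Q x)"
  proof (rule ccontr)
    assume "\<not> ?thesis"
    then have "(\<integral>y. real (nnz d y) \<partial>Q x) = 0"
      by (simp add: not_less order_antisym)
    then have "AE y in Q x. real (nnz d y) = 0"
      using integral_nonneg_eq_0_iff_AE[OF integrable_Q_nnz[OF x]] by auto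
    then have "AE y in Q x. y 0 = 0"
      by eventually_elim (use d in \<open>auto simp: nnz_def\<close>)
    then have "(\<integral>y. y 0 \<partial>Q x) = (\<integral>y. 0 \<partial>Q x)"
      using integrable_Q_coord[OF x, of 0] d by (intro integral_cong_AE) auto
    then show False using integral_Q_coord[OF x, of 0] d by (simp add: x_def)
  qed
  then show ?thesis using nnz_Q_le_expected_density(2)[OF x] by linarith
qed

end

locale marina_run = quantizer d \<omega> Q for d :: nat and \<omega> :: real and Q :: "vec \<Rightarrow> vec measure" +
  fixes n :: nat and fi :: "nat \<Rightarrow> vec \<Rightarrow> real" and Li :: "nat \<Rightarrow> real" and \<gamma> p :: real
  assumes n: "1 \<le> n" and smooth_fi: "\<And>i. i \<in> {1..n} \<Longrightarrow> smooth d (Li i) (fi i)"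
    and p: "0 < p" "p \<le> 1"
begin

section \<open>Notation for one run and measurability of one step\<close>

definition F :: "vec \<Rightarrow> real" where
  "F x = average n (\<lambda>i. fi i x)"

definition gradF :: "vec \<Rightarrow> vec" where
  "gradF x = (\<lambda>j. average n (\<lambda>i. grad d (fi i) x j))"

definition L :: real where
  "L = sqrt (average n (\<lambda>i. (Li i)\<^sup>2))"

definition next_point :: "vec \<Rightarrow> vec \<Rightarrow> vec" where
  "next_point x g = (\<lambda>j. x j - \<gamma> * g j)"

text \<open>Here \<open>x\<close> is the old and \<open>y\<close> the new iterate. Separating the
  law of the messages from the deterministic update \<open>new_state\<close> makes a step a
  push-forward of a product measure, mixed over the coin.\<close>

definition message :: "bool \<Rightarrow> vec \<Rightarrow> vec \<Rightarrow> nat \<Rightarrow> vec measure" where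
  "message c x y i = (if c then return (borelR d) (grad d (fi i) y)
     else Q (\<lambda>j. grad d (fi i) y j - grad d (fi i) x j))"

definition new_state :: "bool \<Rightarrow> vec \<Rightarrow> vec \<Rightarrow> (nat \<Rightarrow> vec) \<Rightarrow> state" where
  "new_state c g y m = (y, \<lambda>j. average n (\<lambda>i. if c then m i j else g j + m i j), m)"

abbreviation S :: "state measure" where
  "S \<equiv> state_space d n"

lemma smooth_F: "smooth d L F"
  and grad_F: "x \<in> Rn d \<Longrightarrow> grad d F x = gradF x"
  using smooth_average[OF n, of d Li fi] grad_average[OF n, of d Li fi] smooth_fi
  by (auto simp: F_def[abs_def] gradF_def[abs_def] L_def)

lemma L_power2: "L\<^sup>2 = average n (\<lambda>i. (Li i)\<^sup>2)"
  by (simp add: L_def average_def sum_nonneg)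

lemma grad_fi_in_Rn: "i \<in> {1..n} \<Longrightarrow> x \<in> Rn d \<Longrightarrow> grad d (fi i) x \<in> Rn d"
  using smooth_fi grad_in_Rn by blast

lemma gradF_in_Rn: "x \<in> Rn d \<Longrightarrow> gradF x \<in> Rn d"
  using grad_in_Rn[OF smooth_F] by (simp add: grad_F)

lemma in_space_S:
  "(x, g, m) \<in> space S \<longleftrightarrow> x \<in> Rn d \<and> g \<in> Rn d \<and> m \<in> ({1..n} \<rightarrow>\<^sub>E Rn d)"
  by (simp add: state_space_def space_pair_measure space_PiM)

lemma next_point_in_Rn: "x \<in> Rn d \<Longrightarrow> g \<in> Rn d \<Longrightarrow> next_point x g \<in> Rn d"
  by (simp add: next_point_def Rn_iff)

lemma measurable_grad_fi [measurable]: "i \<in> {1..n} \<Longrightarrow> grad d (fi i) \<in> borelR d \<rightarrow>\<^sub>M borelR d"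
  using smooth_fi by (rule smooth_grad_measurable)

lemma measurable_S [measurable]:
  "fst \<in> S \<rightarrow>\<^sub>M borelR d"
  "(\<lambda>s. fst (snd s)) \<in> S \<rightarrow>\<^sub>M borelR d"
  "(\<lambda>s. snd (snd s)) \<in> S \<rightarrow>\<^sub>M (\<Pi>\<^sub>M i\<in>{1..n}. borelR d)"
  unfolding state_space_def by measurable

lemma measurable_next_point [measurable]: "(\<lambda>s. next_point (fst s) (fst (snd s))) \<in> S \<rightarrow>\<^sub>M borelR d"
  unfolding measurable_borelR_iff
proof (intro conjI ballI allI)
  show "next_point (fst s) (fst (snd s)) \<in> Rn d" if "s \<in> space S" for s
    using that by (cases s) (auto simp: in_space_S next_point_in_Rn)
qed (unfold next_point_def, measurable)

lemma measurable_message: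
  assumes i: "i \<in> {1..n}"
  shows "(\<lambda>s. message c (fst s) (next_point (fst s) (fst (snd s))) i) \<in> S \<rightarrow>\<^sub>M prob_algebra (borelR d)"
proof (cases c)
  case True
  have "(\<lambda>s. grad d (fi i) (next_point (fst s) (fst (snd s)))) \<in> S \<rightarrow>\<^sub>M borelR d"
    using i by measurable
  from measurable_compose[OF this measurable_return_prob_space] show ?thesis
    by (simp add: message_def True)
next
  case False
  have "(\<lambda>s j. grad d (fi i) (next_point (fst s) (fst (snd s))) j - grad d (fi i) (fst s) j)
      \<in> S \<rightarrow>\<^sub>M borelR d"
    unfolding measurable_borelR_iff
  proof (intro conjI ballI allI)
    show "(\<lambda>j. grad d (fi i) (next_point (fst s) (fst (snd s))) j - grad d (fi i) (fst s) j) \<in> Rn d"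
      if "s \<in> space S" for s
    proof -
      have "fst s \<in> Rn d" "next_point (fst s) (fst (snd s)) \<in> Rn d"
        using that by (cases s; auto simp: in_space_S next_point_in_Rn)+
      from this[THEN grad_fi_in_Rn[OF i]] show ?thesis by (auto simp: Rn_iff)
    qed
    show "(\<lambda>s. grad d (fi i) (next_point (fst s) (fst (snd s))) j - grad d (fi i) (fst s) j)
        \<in> borel_measurable S" for j
      using i by measurable
  qed
  from measurable_compose[OF this measurable_Q] show ?thesis
    by (simp add: message_def False)
qed

lemma measurable_messages:
  "(\<lambda>s. \<Pi>\<^sub>M i\<in>{1..n}. message c (fst s) (next_point (fst s) (fst (snd s))) i)
     \<in> S \<rightarrow>\<^sub>M prob_algebra (\<Pi>\<^sub>M i\<in>{1..n}. borelR d)"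
  by (intro measurable_PiM_prob_kernel measurable_message) auto

lemma new_state_in_S:
  assumes "g \<in> Rn d" "y \<in> Rn d" "m \<in> ({1..n} \<rightarrow>\<^sub>E Rn d)"
  shows "new_state c g y m \<in> space S"
proof -
  have "m i j = 0" if "i \<in> {1..n}" "j \<ge> d" for i j
    using PiE_mem[OF assms(3) that(1)] that(2) by (auto simp: Rn_iff)
  then have "average n (\<lambda>i. if c then m i j else g j + m i j) = 0" if "j \<ge> d" for j
    using assms(1) that by (auto simp: Rn_iff average_def intro!: sum.neutral)
  then show ?thesis using assms by (auto simp: new_state_def in_space_S Rn_iff)
qed

lemma measurable_new_state:
  "(\<lambda>(s, m). new_state c (fst (snd s)) (next_point (fst s) (fst (snd s))) m)
     \<in> S \<Otimes>\<^sub>M (\<Pi>\<^sub>M i\<in>{1..n}. borelR d) \<rightarrow>\<^sub>M S"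
proof -
  let ?P = "S \<Otimes>\<^sub>M (\<Pi>\<^sub>M i\<in>{1..n}. borelR d)"
  have avg: "(\<lambda>z. \<lambda>j. average n (\<lambda>i. if c then snd z i j else fst (snd (fst z)) j + snd z i j)) \<in> ?P \<rightarrow>\<^sub>M borelR d"
    unfolding measurable_borelR_iff
  proof (intro conjI ballI allI)
    fix z assume "z \<in> space ?P"
    then obtain x g m0 m where z: "z = ((x, g, m0), m)" "x \<in> Rn d" "g \<in> Rn d" "m \<in> ({1..n} \<rightarrow>\<^sub>E Rn d)"
      by (cases z) (auto simp: space_pair_measure in_space_S space_PiM)
    show "(\<lambda>j. average n (\<lambda>i. if c then snd z i j else fst (snd (fst z)) j + snd z i j)) \<in> Rn d"
      using new_state_in_S[OF z(3,2,4), of c] by (cases c) (simp_all add: z(1) new_state_def in_space_S)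
  next
    fix j
    have "(\<lambda>z. if c then snd z i j else fst (snd (fst z)) j + snd z i j) \<in> borel_measurable ?P"
      if i: "i \<in> {1..n}" for i
    proof -
      have "(\<lambda>z. snd z i) \<in> ?P \<rightarrow>\<^sub>M borelR d" using i by measurable
      from measurable_coord_compose[OF this, of j]
      have m: "(\<lambda>z. snd z i j) \<in> borel_measurable ?P" .
      have "(\<lambda>z. fst (snd (fst z)) j) \<in> borel_measurable ?P"
        by (rule measurable_coord_compose[OF measurable_compose[OF measurable_fst measurable_S(2)]])
      from borel_measurable_add[OF this m] m show ?thesis
        by (cases c) (simp_all only: if_True if_False)
    qed
    then show "(\<lambda>z. average n (\<lambda>i. if c then snd z i j else fst (snd (fst z)) j + snd z i j)) \<in> borel_measurable ?P"
      unfolding average_def by (intro borel_measurable_divide borel_measurable_sum) auto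
  qed
  have "(\<lambda>z. new_state c (fst (snd (fst z))) (next_point (fst (fst z)) (fst (snd (fst z)))) (snd z)) \<in> ?P \<rightarrow>\<^sub>M S"
    unfolding new_state_def
    by (subst (2) state_space_def, intro measurable_Pair avg) measurable
  then show ?thesis by (simp add: case_prod_unfold)
qed

text \<open>The inner composition with a point mass is a push-forward along
  \<open>new_state\<close>. In this form measurability and integrals of a step reduce to those of
  the messages.\<close>

lemma marina_step_eq:
  assumes s: "s \<in> space S"
  shows "marina_step d n fi Q \<gamma> p s = measure_pmf (bernoulli_pmf p) \<bind> (\<lambda>c.
     distr (\<Pi>\<^sub>M i\<in>{1..n}. message c (fst s) (next_point (fst s) (fst (snd s))) i) S
       (new_state c (fst (snd s)) (next_point (fst s) (fst (snd s)))))"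
proof -
  obtain x g m0 where xg: "s = (x, g, m0)" by (cases s)
  have "(\<Pi>\<^sub>M i\<in>{1..n}. message c x (next_point x g) i) \<bind> (\<lambda>m. return S (new_state c g (next_point x g) m))
    = distr (\<Pi>\<^sub>M i\<in>{1..n}. message c x (next_point x g) i) S (new_state c g (next_point x g))" for c
  proof (rule bind_return_distr')
    have "(\<Pi>\<^sub>M i\<in>{1..n}. message c x (next_point x g) i) \<in> space (prob_algebra (\<Pi>\<^sub>M i\<in>{1..n}. borelR d))"
      using measurable_space[OF measurable_messages s, of c] by (simp add: xg)
    then have P: "prob_space (\<Pi>\<^sub>M i\<in>{1..n}. message c x (next_point x g) i)"
      "sets (\<Pi>\<^sub>M i\<in>{1..n}. message c x (next_point x g) i) = sets (\<Pi>\<^sub>M i\<in>{1..n}. borelR d)"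
      by (auto simp: space_prob_algebra)
    show "space (\<Pi>\<^sub>M i\<in>{1..n}. message c x (next_point x g) i) \<noteq> {}"
      using P(1) by (rule prob_space.not_empty)
    have "new_state c g (next_point x g) \<in> (\<Pi>\<^sub>M i\<in>{1..n}. borelR d) \<rightarrow>\<^sub>M S"
      using measurable_Pair2[OF measurable_new_state s, of c] by (simp add: xg)
    then show "new_state c g (next_point x g) \<in> (\<Pi>\<^sub>M i\<in>{1..n}. message c x (next_point x g) i) \<rightarrow>\<^sub>M S"
      using P(2) measurable_cong_sets by blast
  qed
  moreover have "(if c then m i else (\<lambda>j. g j + m i j)) j = (if c then m i j else g j + m i j)"
    for c :: bool and m :: "nat \<Rightarrow> vec" and i j by simp
  ultimately show ?thesis
    unfolding xg by (simp add: marina_step_def Let_def message_def new_state_def next_point_def)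
qed

lemma measurable_outcome:
  "(\<lambda>s. distr (\<Pi>\<^sub>M i\<in>{1..n}. message c (fst s) (next_point (fst s) (fst (snd s))) i) S
       (new_state c (fst (snd s)) (next_point (fst s) (fst (snd s))))) \<in> S \<rightarrow>\<^sub>M prob_algebra S"
  using measurable_messages measurable_new_state by (rule measurable_distr_prob_space2)

lemma measurable_marina_step: "marina_step d n fi Q \<gamma> p \<in> S \<rightarrow>\<^sub>M prob_algebra S"
proof -
  let ?D = "\<lambda>s c. distr (\<Pi>\<^sub>M i\<in>{1..n}. message c (fst s) (next_point (fst s) (fst (snd s))) i) S
       (new_state c (fst (snd s)) (next_point (fst s) (fst (snd s))))"
  have "(\<lambda>s. measure_pmf (bernoulli_pmf p) \<bind> ?D s) \<in> S \<rightarrow>\<^sub>M prob_algebra S"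
  proof (rule measurable_bind_prob_space2)
    show "(\<lambda>s. measure_pmf (bernoulli_pmf p)) \<in> S \<rightarrow>\<^sub>M prob_algebra (count_space UNIV)"
      by (intro measurable_const) (auto simp: space_prob_algebra prob_space_measure_pmf)
    \<comment> \<open>The coin has only two values, so joint measurability follows from
      measurability in the state for each fixed value of the coin.\<close>
    have "(\<lambda>z. (\<lambda>c s. ?D s c) (snd z) (fst z)) \<in> S \<Otimes>\<^sub>M count_space (UNIV :: bool set) \<rightarrow>\<^sub>M prob_algebra S"
      by (rule measurable_compose_countable[OF _ measurable_snd])
         (rule measurable_compose[OF measurable_fst measurable_outcome])
    then show "(\<lambda>(s, c). ?D s c) \<in> S \<Otimes>\<^sub>M count_space UNIV \<rightarrow>\<^sub>M prob_algebra S"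
      by (simp add: case_prod_unfold)
  qed
  then show ?thesis by (subst measurable_cong[OF marina_step_eq])
qed

lemma nn_integral_marina_step:
  assumes s: "(x, g, m0) \<in> space S" and h: "h \<in> borel_measurable S"
  defines "y \<equiv> next_point x g"
  shows "(\<integral>\<^sup>+z. h z \<partial>marina_step d n fi Q \<gamma> p (x, g, m0))
    = (\<integral>\<^sup>+m. h (new_state True g y m) \<partial>(\<Pi>\<^sub>M i\<in>{1..n}. message True x y i)) * ennreal p
    + (\<integral>\<^sup>+m. h (new_state False g y m) \<partial>(\<Pi>\<^sub>M i\<in>{1..n}. message False x y i)) * ennreal (1 - p)"
proof -
  let ?D = "\<lambda>c. distr (\<Pi>\<^sub>M i\<in>{1..n}. message c x y i) S (new_state c g y)"
  have D: "?D c \<in> space (subprob_algebra S)" for c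
    using measurable_space[OF measurable_prob_algebraD[OF measurable_outcome] s, of c] by (simp add: y_def)
  have new: "new_state c g y \<in> (\<Pi>\<^sub>M i\<in>{1..n}. message c x y i) \<rightarrow>\<^sub>M S" for c
  proof -
    have "sets (\<Pi>\<^sub>M i\<in>{1..n}. message c x y i) = sets (\<Pi>\<^sub>M i\<in>{1..n}. borelR d)"
      using measurable_space[OF measurable_messages s, of c] by (simp add: y_def space_prob_algebra)
    moreover have "new_state c g y \<in> (\<Pi>\<^sub>M i\<in>{1..n}. borelR d) \<rightarrow>\<^sub>M S"
      using measurable_Pair2[OF measurable_new_state s, of c] by (simp add: y_def)
    ultimately show ?thesis using measurable_cong_sets by blast
  qed
  have "(\<integral>\<^sup>+z. h z \<partial>marina_step d n fi Q \<gamma> p (x, g, m0))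
      = (\<integral>\<^sup>+c. \<integral>\<^sup>+z. h z \<partial>?D c \<partial>measure_pmf (bernoulli_pmf p))"
    unfolding marina_step_eq[OF s] using D
    by (subst nn_integral_bind[OF h]) (auto simp: y_def measurable_def)
  also have "\<dots> = (\<integral>\<^sup>+z. h z \<partial>?D True) * ennreal p + (\<integral>\<^sup>+z. h z \<partial>?D False) * ennreal (1 - p)"
    using p by (subst nn_integral_bernoulli_pmf) auto
  finally show ?thesis using h new by (simp add: nn_integral_distr)
qed

text \<open>Each coordinate of the product is a point mass, and the finitely many exceptional null
  sets can be combined. With this, the estimator is the exact gradient whenever the coin shows
  1.\<close>

lemma full_messages:
  assumes y: "y \<in> Rn d"
  shows "AE m in (\<Pi>\<^sub>M i\<in>{1..n}. message True x y i). \<forall>i\<in>{1..n}. m i = grad d (fi i) y"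
proof (subst AE_finite_all, safe)
  fix i assume i: "i \<in> {1..n}"
  have "prob_space (message True x y i)" if "i \<in> {1..n}" for i
    using grad_fi_in_Rn[OF that y] by (simp add: message_def prob_space_return)
  moreover have "AE v in message True x y i. v = grad d (fi i) y"
  proof -
    have "Measurable.pred (borelR d) (\<lambda>v. v = grad d (fi i) y)"
      unfolding fun_eq_iff by measurable
    then show ?thesis
      unfolding message_def if_True using grad_fi_in_Rn[OF i y] by (subst AE_return) auto
  qed
  ultimately show "AE m in (\<Pi>\<^sub>M i\<in>{1..n}. message True x y i). m i = grad d (fi i) y"
    using i by (intro AE_PiM_component) auto
qed

text \<open>In each coordinate the new error is the old error plus a sum of independent centered
  noises, so the expected squares add. The noise variances are bounded through
  \<open>quantization\<close> and the smoothness of each \<open>fi i\<close>; the weights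
  \<open>1 / n\<close> then combine the \<open>Li\<close> into \<open>L\<close>.\<close>

lemma quantized_messages_error:
  assumes x: "x \<in> Rn d" and y: "y \<in> Rn d" and g: "g \<in> Rn d"
  defines "err \<equiv> (\<lambda>m. (edist d (fst (snd (new_state False g y m))) (gradF y))\<^sup>2)"
  defines "P \<equiv> (\<Pi>\<^sub>M i\<in>{1..n}. message False x y i)"
  shows "integrable P err"
    and "(\<integral>m. err m \<partial>P) \<le> (edist d g (gradF x))\<^sup>2 + \<omega> / real n * L\<^sup>2 * (edist d y x)\<^sup>2"
proof -
  define D where "D i = (\<lambda>j. grad d (fi i) y j - grad d (fi i) x j)" for i
  have D: "D i \<in> Rn d" if "i \<in> {1..n}" for i
    using grad_fi_in_Rn[OF that x] grad_fi_in_Rn[OF that y] by (simp add: D_def Rn_iff)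
  have P: "P = (\<Pi>\<^sub>M i\<in>{1..n}. Q (D i))" by (simp add: P_def message_def D_def)
  \<comment> \<open>The noise of worker \<open>i\<close> in coordinate \<open>j\<close>; dividing by
    \<open>n\<close> here turns the average over the workers into a plain sum.\<close>
  define X where "X j i v = (v j - D i j) / real n" for j i and v :: vec
  have err: "err m = (\<Sum>j<d. ((g j - gradF x j) + (\<Sum>i\<in>{1..n}. X j i (m i)))\<^sup>2)" for m
  proof -
    have "average n (\<lambda>i. g j + m i j) - gradF y j = (g j - gradF x j) + (\<Sum>i\<in>{1..n}. X j i (m i))" for j
    proof -
      have "(g j - gradF x j) + (\<Sum>i\<in>{1..n}. X j i (m i))
          = average n (\<lambda>_. g j) - gradF x j + average n (\<lambda>i. m i j - D i j)"
        by (simp only: average_const[OF n] X_def) (simp add: average_def sum_divide_distrib)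
      also have "\<dots> = average n (\<lambda>i. g j + m i j) - gradF y j"
        by (simp add: average_def gradF_def D_def sum.distrib sum_subtractf field_simps)
      finally show ?thesis by simp
    qed
    then show ?thesis by (simp add: err_def new_state_def edist_power2)
  qed
  have X: "integrable (Q (D i)) (X j i)" "(\<integral>v. X j i v \<partial>Q (D i)) = 0"
    "integrable (Q (D i)) (\<lambda>v. (X j i v)\<^sup>2)" if i: "i \<in> {1..n}" and j: "j < d" for i j
  proof -
    interpret prob_space "Q (D i)" using D[OF i] by (rule prob_space_Q)
    note [measurable_cong] = sets_Q[OF D[OF i]]
    show "integrable (Q (D i)) (X j i)" "(\<integral>v. X j i v \<partial>Q (D i)) = 0"
      unfolding X_def using integrable_Q_coord[OF D[OF i] j] integral_Q_coord[OF D[OF i] j]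
      by (simp_all add: prob_space)
    show "integrable (Q (D i)) (\<lambda>v. (X j i v)\<^sup>2)"
    proof (rule Bochner_Integration.integrable_bound)
      show "integrable (Q (D i)) (\<lambda>v. (edist d v (D i))\<^sup>2 / (real n)\<^sup>2)"
        using integrable_Q_edist[OF D[OF i]] by simp
      show "(\<lambda>v. (X j i v)\<^sup>2) \<in> borel_measurable (Q (D i))"
        unfolding X_def by measurable
      have "(v j - D i j)\<^sup>2 \<le> (edist d v (D i))\<^sup>2" for v
        using abs_coord_le_edist[OF j, of v "D i"] by (metis abs_ge_zero power2_abs power_mono)
      then show "AE v in Q (D i). norm ((X j i v)\<^sup>2) \<le> norm ((edist d v (D i))\<^sup>2 / (real n)\<^sup>2)"
        by (simp add: X_def power_divide divide_right_mono)
    qed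
  qed
  note sums = integrable_PiM_sum_power2[OF finite_atLeastAtMost prob_space_Q[OF D] X(1) X(3) X(2)]
    integral_PiM_sum_power2(2)[OF finite_atLeastAtMost prob_space_Q[OF D] X(1) X(3) X(2)]
  show "integrable P err"
    unfolding err[abs_def] P by (intro Bochner_Integration.integrable_sum sums) auto
  have "(\<integral>m. err m \<partial>P) = (\<Sum>j<d. (g j - gradF x j)\<^sup>2 + (\<Sum>i\<in>{1..n}. \<integral>v. (X j i v)\<^sup>2 \<partial>Q (D i)))"
    unfolding err P
    by (subst Bochner_Integration.integral_sum) (auto intro!: sums sum.cong)
  \<comment> \<open>The sums are exchanged because the variance bound of a quantizer is known only
    for all coordinates together, that is, for each worker as a whole.\<close>
  also have "\<dots> = (edist d g (gradF x))\<^sup>2 + (\<Sum>i\<in>{1..n}. \<Sum>j<d. \<integral>v. (X j i v)\<^sup>2 \<partial>Q (D i))"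
    unfolding sum.distrib edist_power2 by (subst sum.swap) simp
  also have "(\<Sum>i\<in>{1..n}. \<Sum>j<d. \<integral>v. (X j i v)\<^sup>2 \<partial>Q (D i))
      \<le> (\<Sum>i\<in>{1..n}. \<omega> / (real n)\<^sup>2 * ((Li i)\<^sup>2 * (edist d y x)\<^sup>2))"
  proof (rule sum_mono)
    fix i assume i: "i \<in> {1..n}"
    have "(\<Sum>j<d. \<integral>v. (X j i v)\<^sup>2 \<partial>Q (D i)) = (\<integral>v. (\<Sum>j<d. (X j i v)\<^sup>2) \<partial>Q (D i))"
      by (subst Bochner_Integration.integral_sum) (auto intro!: X i)
    also have "\<dots> = (\<integral>v. (edist d v (D i))\<^sup>2 \<partial>Q (D i)) / (real n)\<^sup>2"
      by (simp add: X_def power_divide sum_divide_distrib[symmetric] edist_power2)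
    also have "\<dots> \<le> \<omega> * (enorm d (D i))\<^sup>2 / (real n)\<^sup>2"
      by (intro divide_right_mono integral_Q_edist D i) simp
    also have "\<dots> \<le> \<omega> * ((Li i)\<^sup>2 * (edist d y x)\<^sup>2) / (real n)\<^sup>2"
    proof (intro divide_right_mono mult_left_mono)
      have "enorm d (D i) \<le> Li i * edist d y x"
        using smooth_grad_lipschitz[OF smooth_fi[OF i] y x] by (simp add: D_def edist_def)
      from power_mono[OF this, of 2] show "(enorm d (D i))\<^sup>2 \<le> (Li i)\<^sup>2 * (edist d y x)\<^sup>2"
        by (simp add: power_mult_distrib)
    qed (use quant in \<open>auto simp: quantization_def\<close>)
    finally show "(\<Sum>j<d. \<integral>v. (X j i v)\<^sup>2 \<partial>Q (D i)) \<le> \<omega> / (real n)\<^sup>2 * ((Li i)\<^sup>2 * (edist d y x)\<^sup>2)"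
      by simp
  qed
  also have "\<dots> = \<omega> / real n * L\<^sup>2 * (edist d y x)\<^sup>2"
    unfolding L_power2 average_def
    by (simp add: sum_distrib_left sum_distrib_right sum_divide_distrib power2_eq_square mult_ac)
  finally show "(\<integral>m. err m \<partial>P) \<le> (edist d g (gradF x))\<^sup>2 + \<omega> / real n * L\<^sup>2 * (edist d y x)\<^sup>2"
    by simp
qed

section \<open>Measurability of the objective and of the potential\<close>

lemma measurable_F [measurable]: "F \<in> borel_measurable (borelR d)"
  by (rule smooth_measurable[OF smooth_F])

lemma measurable_gradF [measurable]: "gradF \<in> borelR d \<rightarrow>\<^sub>M borelR d"
proof -
  have "grad d F \<in> borelR d \<rightarrow>\<^sub>M borelR d \<longleftrightarrow> gradF \<in> borelR d \<rightarrow>\<^sub>M borelR d"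
    by (rule measurable_cong) (simp add: grad_F)
  then show ?thesis using smooth_grad_measurable[OF smooth_F] by simp
qed

lemma prob_space_messages:
  assumes "x \<in> Rn d" "y \<in> Rn d" "i \<in> {1..n}"
  shows "prob_space (message c x y i)" and "sets (message c x y i) = sets (borelR d)"
proof -
  have "(\<lambda>j. grad d (fi i) y j - grad d (fi i) x j) \<in> Rn d"
    using grad_fi_in_Rn[OF assms(3,1)] grad_fi_in_Rn[OF assms(3,2)] by (simp add: Rn_iff)
  then show "prob_space (message c x y i)" "sets (message c x y i) = sets (borelR d)"
    using grad_fi_in_Rn[OF assms(3,2)] prob_space_Q sets_Q
    by (auto simp: message_def prob_space_return)
qed

definition potential :: "real \<Rightarrow> state \<Rightarrow> real" where
  "potential fs s = F (fst s) - fs + \<gamma> / p * (edist d (fst (snd s)) (gradF (fst s)))\<^sup>2"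

lemma measurable_potential [measurable]: "potential fs \<in> borel_measurable S"
proof -
  have [measurable]: "(\<lambda>s. gradF (fst s)) \<in> S \<rightarrow>\<^sub>M borelR d" by measurable
  have [measurable]: "(\<lambda>s. gradF (fst s) j) \<in> borel_measurable S" for j by measurable
  have [measurable]: "(\<lambda>s. fst (snd s) j) \<in> borel_measurable S" for j by measurable
  show ?thesis unfolding potential_def[abs_def] edist_power2 by measurable
qed

section \<open>Contraction of the potential\<close>

text \<open>The polarization identity replaces the inner product of the gradient with the step
  \<open>- \<gamma> * g\<close> by three squared norms in the descent inequality of
  smoothness.\<close>

lemma descent_step:
  assumes x: "x \<in> Rn d" and g: "g \<in> Rn d"
  shows "F (next_point x g) \<le> F x - \<gamma> / 2 * (enorm d (gradF x))\<^sup>2 + \<gamma> / 2 * (edist d g (gradF x))\<^sup>2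
    - \<gamma> / 2 * (1 - L * \<gamma>) * (enorm d g)\<^sup>2"
    and edist_next_point: "(edist d (next_point x g) x)\<^sup>2 = \<gamma>\<^sup>2 * (enorm d g)\<^sup>2"
proof -
  show r: "(edist d (next_point x g) x)\<^sup>2 = \<gamma>\<^sup>2 * (enorm d g)\<^sup>2"
    by (simp add: edist_power2 next_point_def enorm_power2 power_mult_distrib sum_distrib_left)
  have polar: "(\<Sum>j<d. gradF x j * (next_point x g j - x j))
    = \<gamma> / 2 * ((edist d g (gradF x))\<^sup>2 - (enorm d (gradF x))\<^sup>2 - (enorm d g)\<^sup>2)"
    unfolding edist_power2 enorm_power2 sum_subtractf[symmetric] sum_distrib_left next_point_def
    by (intro sum.cong) (simp_all add: power2_eq_square field_simps)
  show "F (next_point x g) \<le> F x - \<gamma> / 2 * (enorm d (gradF x))\<^sup>2 + \<gamma> / 2 * (edist d g (gradF x))\<^sup>2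
    - \<gamma> / 2 * (1 - L * \<gamma>) * (enorm d g)\<^sup>2"
    using smooth_descent[OF smooth_F x next_point_in_Rn[OF x g]]
    unfolding r grad_F[OF x] polar by (simp add: power2_eq_square field_simps)
qed

lemma potential_step:
  assumes s: "s \<in> space S"
    and \<mu>: "0 < \<mu>" and \<gamma>: "0 < \<gamma>" "\<gamma> * \<mu> \<le> p / 2"
    and stepsize: "L * \<gamma> + 2 * \<omega> * (1 - p) / (p * real n) * (L * \<gamma>)\<^sup>2 \<le> 1"
    and fs: "\<And>x. x \<in> Rn d \<Longrightarrow> fs \<le> F x"
    and PL: "\<And>x. x \<in> Rn d \<Longrightarrow> 2 * \<mu> * (F x - fs) \<le> (enorm d (gradF x))\<^sup>2"
  shows "(\<integral>\<^sup>+z. ennreal (potential fs z) \<partial>marina_step d n fi Q \<gamma> p s)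
    \<le> ennreal ((1 - \<gamma> * \<mu>) * potential fs s)"
proof -
  obtain x g m0 where sx: "s = (x, g, m0)" by (cases s)
  have x: "x \<in> Rn d" and g: "g \<in> Rn d" using s by (auto simp: sx in_space_S)
  define y where "y = next_point x g"
  have y: "y \<in> Rn d" unfolding y_def using x g by (rule next_point_in_Rn)
  define a where "a = F y - fs"
  define e where "e = (edist d g (gradF x))\<^sup>2"
  define w where "w = (enorm d g)\<^sup>2"
  have a0: "0 \<le> a" using fs[OF y] by (simp add: a_def)
  \<comment> \<open>Given the current state, the expected new potential is exactly \<open>a\<close>
    if the coin shows 1, and at most \<open>b\<close> otherwise.\<close>
  define b where "b = a + \<gamma> / p * (e + \<omega> / real n * L\<^sup>2 * (\<gamma>\<^sup>2 * w))"
  let ?P = "\<lambda>c. \<Pi>\<^sub>M i\<in>{1..n}. message c x y i"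
  have P: "prob_space (?P c)" for c
    by (intro prob_space_PiM prob_space_messages x y)
  have "(\<integral>\<^sup>+m. ennreal (potential fs (new_state True g y m)) \<partial>?P True) = (\<integral>\<^sup>+m. ennreal a \<partial>?P True)"
  proof (rule nn_integral_cong_AE)
    show "AE m in ?P True. ennreal (potential fs (new_state True g y m)) = ennreal a"
      using full_messages[OF y, of x]
    proof eventually_elim
      case (elim m)
      then have "(\<lambda>j. average n (\<lambda>i. m i j)) = gradF y"
        unfolding gradF_def by (intro ext average_cong) simp
      then show ?case
        by (simp add: potential_def new_state_def a_def edist_def enorm_def L2_set_def)
    qed
  qed
  then have A: "(\<integral>\<^sup>+m. ennreal (potential fs (new_state True g y m)) \<partial>?P True) = ennreal a"
    using prob_space.emeasure_space_1[OF P, of True] by simp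
  let ?err = "\<lambda>m. (edist d (fst (snd (new_state False g y m))) (gradF y))\<^sup>2"
  note err = quantized_messages_error[OF x y g]
  interpret PF: prob_space "?P False" by (rule P)
  have "(\<integral>\<^sup>+m. ennreal (potential fs (new_state False g y m)) \<partial>?P False)
      = (\<integral>\<^sup>+m. ennreal (a + \<gamma> / p * ?err m) \<partial>?P False)"
    by (simp add: potential_def a_def new_state_def)
  also have "\<dots> = ennreal (\<integral>m. a + \<gamma> / p * ?err m \<partial>?P False)"
    using a0 \<gamma> p
    by (intro nn_integral_eq_integral Bochner_Integration.integrable_add integrable_mult_right
      PF.integrable_const err(1) AE_I2) auto
  also have "\<dots> = ennreal (a + \<gamma> / p * (\<integral>m. ?err m \<partial>?P False))"
    unfolding Bochner_Integration.integral_add[OF PF.integrable_const integrable_mult_right[OF err(1)]]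
    using PF.prob_space by simp
  also have "\<dots> \<le> ennreal b"
    unfolding b_def e_def w_def edist_next_point[OF x g, symmetric] y_def[symmetric]
    using err(2) \<gamma> p by (intro ennreal_leI add_left_mono mult_left_mono) auto
  finally have B: "(\<integral>\<^sup>+m. ennreal (potential fs (new_state False g y m)) \<partial>?P False) \<le> ennreal b" .
  have b0: "0 \<le> b"
    unfolding b_def e_def w_def using a0 \<gamma> p quant by (auto simp: quantization_def)
  have "(\<integral>\<^sup>+z. ennreal (potential fs z) \<partial>marina_step d n fi Q \<gamma> p s)
      \<le> ennreal a * ennreal p + ennreal b * ennreal (1 - p)"
    unfolding sx using s B A
    by (subst nn_integral_marina_step) (auto simp: sx y_def intro!: add_mono mult_right_mono)
  also have "\<dots> = ennreal (a * p + b * (1 - p))"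
    using a0 b0 p by (simp add: ennreal_mult ennreal_plus)
  \<comment> \<open>The coefficient of \<open>w\<close> is written so that the second summand of
    \<open>stepsize\<close> appears in it.\<close>
  also have "a * p + b * (1 - p) = a + \<gamma> * (1 - p) / p * e
      + \<gamma> / 2 * (2 * \<omega> * (1 - p) / (p * real n) * (L * \<gamma>)\<^sup>2) * w"
    using p n by (simp add: b_def field_simps power2_eq_square)
  also have "\<dots> \<le> (1 - \<gamma> * \<mu>) * potential fs s"
  proof -
    have "\<gamma> / 2 * (2 * \<mu> * (F x - fs)) \<le> \<gamma> / 2 * (enorm d (gradF x))\<^sup>2"
      using PL[OF x] \<gamma> by (intro mult_left_mono) auto
    \<comment> \<open>The Polyak-Lojasiewicz condition trades the gradient term of the descent step
      for the contraction of the gap.\<close>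
    then have 1: "a \<le> (1 - \<gamma> * \<mu>) * (F x - fs) + \<gamma> / 2 * e - \<gamma> / 2 * (1 - L * \<gamma>) * w"
      using descent_step[OF x g] unfolding a_def e_def w_def y_def by (simp add: algebra_simps)
    have "\<gamma> / 2 * w * (L * \<gamma> + 2 * \<omega> * (1 - p) / (p * real n) * (L * \<gamma>)\<^sup>2) \<le> \<gamma> / 2 * w * 1"
      using stepsize \<gamma> by (intro mult_left_mono) (auto simp: w_def)
    then have 2: "\<gamma> / 2 * (2 * \<omega> * (1 - p) / (p * real n) * (L * \<gamma>)\<^sup>2) * w \<le> \<gamma> / 2 * (1 - L * \<gamma>) * w"
      by (simp add: algebra_simps)
    \<comment> \<open>This balance explains the weight \<open>\<gamma> / p\<close> of the potential:
      the descent step contributes \<open>\<gamma> / 2\<close>, the surviving error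
      \<open>\<gamma> * (1 - p) / p\<close>, and together they leave the factor
      \<open>1 - p / 2\<close>, which is at most \<open>1 - \<gamma> * \<mu>\<close>.\<close>
    have "\<gamma> / 2 * e + \<gamma> * (1 - p) / p * e = (\<gamma> / p * e) * (1 - p / 2)"
      using p by (simp add: field_simps)
    also have "\<dots> \<le> (\<gamma> / p * e) * (1 - \<gamma> * \<mu>)"
      using \<gamma> p by (intro mult_left_mono) (auto simp: e_def)
    finally have 3: "\<gamma> / 2 * e + \<gamma> * (1 - p) / p * e \<le> (\<gamma> / p * e) * (1 - \<gamma> * \<mu>)" .
    have "(1 - \<gamma> * \<mu>) * potential fs s = (1 - \<gamma> * \<mu>) * (F x - fs) + (\<gamma> / p * e) * (1 - \<gamma> * \<mu>)"
      by (simp add: potential_def sx e_def algebra_simps)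
    with 1 2 3 show ?thesis by linarith
  qed
  finally show ?thesis by (simp add: ennreal_leI)
qed

section \<open>Iteration of the kernel and decay of the expected gap\<close>

lemma marina_0:
  "x0 \<in> Rn d \<Longrightarrow> marina d n fi Q \<gamma> p x0 0 = return S (x0, gradF x0, \<lambda>i\<in>{1..n}. grad d (fi i) x0)"
  using grad_F[of x0] by (simp add: F_def[abs_def])

lemma initial_state_in_S:
  "x0 \<in> Rn d \<Longrightarrow> (x0, gradF x0, \<lambda>i\<in>{1..n}. grad d (fi i) x0) \<in> space S"
  by (simp add: in_space_S gradF_in_Rn grad_fi_in_Rn)

lemma marina_in_prob_algebra:
  "x0 \<in> Rn d \<Longrightarrow> marina d n fi Q \<gamma> p x0 k \<in> space (prob_algebra S)"
proof (induction k)
  case 0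
  then show ?case
    using initial_state_in_S by (simp add: marina_0 space_prob_algebra prob_space_return del: marina.simps)
next
  case (Suc k)
  from measurable_space[OF measurable_bind_prob_space[OF measurable_ident_sets[OF refl]
      measurable_marina_step] Suc.IH[OF Suc.prems]]
  show ?case by simp
qed

lemma space_marina: "x0 \<in> Rn d \<Longrightarrow> space (marina d n fi Q \<gamma> p x0 k) = space S"
  and sets_marina: "x0 \<in> Rn d \<Longrightarrow> sets (marina d n fi Q \<gamma> p x0 k) = sets S"
  using marina_in_prob_algebra[of x0 k] by (auto simp: space_prob_algebra dest: sets_eq_imp_space_eq)

text \<open>The tower property: a bound conditional on the current state is integrated over the law
  of that state. It serves for the potential as well as for the message cost.\<close>

lemma nn_integral_marina_Suc_le:
  assumes x0: "x0 \<in> Rn d" and h: "h \<in> borel_measurable S"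
    and step: "\<And>s. s \<in> space S \<Longrightarrow> (\<integral>\<^sup>+z. h z \<partial>marina_step d n fi Q \<gamma> p s) \<le> H s"
  shows "(\<integral>\<^sup>+z. h z \<partial>marina d n fi Q \<gamma> p x0 (Suc k)) \<le> (\<integral>\<^sup>+s. H s \<partial>marina d n fi Q \<gamma> p x0 k)"
proof -
  have "marina_step d n fi Q \<gamma> p \<in> marina d n fi Q \<gamma> p x0 k \<rightarrow>\<^sub>M subprob_algebra S"
    using measurable_prob_algebraD[OF measurable_marina_step] sets_marina[OF x0]
      measurable_cong_sets by blast
  then have "(\<integral>\<^sup>+z. h z \<partial>marina d n fi Q \<gamma> p x0 (Suc k))
      = (\<integral>\<^sup>+s. \<integral>\<^sup>+z. h z \<partial>marina_step d n fi Q \<gamma> p s \<partial>marina d n fi Q \<gamma> p x0 k)"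
    using h by (simp add: nn_integral_bind)
  also have "\<dots> \<le> (\<integral>\<^sup>+s. H s \<partial>marina d n fi Q \<gamma> p x0 k)"
    using step by (intro nn_integral_mono) (simp add: space_marina[OF x0])
  finally show ?thesis .
qed

text \<open>The contraction is iterated for nonnegative integrals, starting from error 0; dropping
  the error term of the potential leaves the gap. Finiteness of the resulting bound then also yields
  integrability.\<close>

lemma marina_convergence:
  assumes x0: "x0 \<in> Rn d"
    and \<mu>: "0 < \<mu>" and \<gamma>: "0 < \<gamma>" "\<gamma> * \<mu> \<le> p / 2"
    and stepsize: "L * \<gamma> + 2 * \<omega> * (1 - p) / (p * real n) * (L * \<gamma>)\<^sup>2 \<le> 1"
    and fs: "\<And>x. x \<in> Rn d \<Longrightarrow> fs \<le> F x"
    and PL: "\<And>x. x \<in> Rn d \<Longrightarrow> 2 * \<mu> * (F x - fs) \<le> (enorm d (gradF x))\<^sup>2"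
  shows "integrable (marina d n fi Q \<gamma> p x0 K) (\<lambda>s. F (fst s) - fs)"
    and "(\<integral>s. F (fst s) - fs \<partial>marina d n fi Q \<gamma> p x0 K) \<le> (1 - \<gamma> * \<mu>) ^ K * (F x0 - fs)"
proof -
  have q: "0 \<le> 1 - \<gamma> * \<mu>" using \<gamma>(2) p by linarith
  have pot: "(\<integral>\<^sup>+s. ennreal (potential fs s) \<partial>marina d n fi Q \<gamma> p x0 k)
    \<le> ennreal ((1 - \<gamma> * \<mu>) ^ k * (F x0 - fs))" for k
  proof (induction k)
    case 0
    have "potential fs (x0, gradF x0, m) = F x0 - fs" for m
      by (simp add: potential_def edist_def enorm_def L2_set_def)
    then show ?case
      unfolding marina_0[OF x0] using initial_state_in_S[OF x0] by (subst nn_integral_return) auto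
  next
    case (Suc k)
    have "(\<integral>\<^sup>+s. ennreal (potential fs s) \<partial>marina d n fi Q \<gamma> p x0 (Suc k))
        \<le> (\<integral>\<^sup>+s. ennreal ((1 - \<gamma> * \<mu>) * potential fs s) \<partial>marina d n fi Q \<gamma> p x0 k)"
      using x0 by (intro nn_integral_marina_Suc_le potential_step assms) auto
    also have "\<dots> = ennreal (1 - \<gamma> * \<mu>) * (\<integral>\<^sup>+s. ennreal (potential fs s) \<partial>marina d n fi Q \<gamma> p x0 k)"
      unfolding ennreal_mult'[OF q] using measurable_potential sets_marina[OF x0]
      by (intro nn_integral_cmult) (simp cong: measurable_cong_sets)
    also have "\<dots> \<le> ennreal (1 - \<gamma> * \<mu>) * ennreal ((1 - \<gamma> * \<mu>) ^ k * (F x0 - fs))"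
      by (intro mult_left_mono Suc) simp
    also have "\<dots> = ennreal ((1 - \<gamma> * \<mu>) ^ Suc k * (F x0 - fs))"
      using q by (simp add: ennreal_mult'[symmetric] mult_ac)
    finally show ?case .
  qed
  have pos: "0 \<le> F (fst s) - fs" if "s \<in> space (marina d n fi Q \<gamma> p x0 K)" for s
    using that fs by (cases s) (simp add: space_marina[OF x0] in_space_S)
  have "(\<integral>\<^sup>+s. ennreal (F (fst s) - fs) \<partial>marina d n fi Q \<gamma> p x0 K)
      \<le> (\<integral>\<^sup>+s. ennreal (potential fs s) \<partial>marina d n fi Q \<gamma> p x0 K)"
    using \<gamma> p by (intro nn_integral_mono ennreal_leI) (simp add: potential_def)
  also note pot[of K]
  finally have le: "(\<integral>\<^sup>+s. ennreal (F (fst s) - fs) \<partial>marina d n fi Q \<gamma> p x0 K)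
      \<le> ennreal ((1 - \<gamma> * \<mu>) ^ K * (F x0 - fs))" .
  show "integrable (marina d n fi Q \<gamma> p x0 K) (\<lambda>s. F (fst s) - fs)"
  proof (rule integrableI_nonneg)
    have "(\<lambda>s. F (fst s) - fs) \<in> borel_measurable S" by measurable
    then show "(\<lambda>s. F (fst s) - fs) \<in> borel_measurable (marina d n fi Q \<gamma> p x0 K)"
      using measurable_cong_sets[OF sets_marina[OF x0] refl] by blast
    show "AE s in marina d n fi Q \<gamma> p x0 K. 0 \<le> F (fst s) - fs" using pos by (rule AE_I2)
    show "(\<integral>\<^sup>+s. ennreal (F (fst s) - fs) \<partial>marina d n fi Q \<gamma> p x0 K) < \<infinity>"
      by (rule le_less_trans[OF le]) simp
  qed
  show "(\<integral>s. F (fst s) - fs \<partial>marina d n fi Q \<gamma> p x0 K) \<le> (1 - \<gamma> * \<mu>) ^ K * (F x0 - fs)"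
    using fs[OF x0] q by (intro integral_real_bounded le) simp
qed

section \<open>Communication cost\<close>

lemma measurable_message_cost:
  assumes i: "i \<in> {1..n}"
  shows "(\<lambda>z. ennreal (real (nnz d (snd (snd z) i)))) \<in> borel_measurable S"
proof -
  have "(\<lambda>z. snd (snd z) i) \<in> S \<rightarrow>\<^sub>M borelR d"
    using i by (intro measurable_compose[OF measurable_S(3)]) measurable
  from measurable_compose[OF measurable_compose[OF this nnz_measurable] measurable_ennreal]
  show ?thesis .
qed

text \<open>Only the marginal law of worker \<open>i\<close> matters. A full gradient costs at most
  \<open>d\<close>, a quantized difference at most the density in expectation, and the coin mixes
  the two.\<close>

lemma nn_integral_message_cost_step:
  assumes s: "s \<in> space S" and i: "i \<in> {1..n}"
  shows "(\<integral>\<^sup>+z. ennreal (real (nnz d (snd (snd z) i))) \<partial>marina_step d n fi Q \<gamma> p s)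
    \<le> ennreal (p * real d + (1 - p) * expected_density d Q)"
proof -
  obtain x g m0 where sx: "s = (x, g, m0)" by (cases s)
  have x: "x \<in> Rn d" and g: "g \<in> Rn d" using s by (auto simp: sx in_space_S)
  define y where "y = next_point x g"
  have y: "y \<in> Rn d" unfolding y_def using x g by (rule next_point_in_Rn)
  define D where "D = (\<lambda>j. grad d (fi i) y j - grad d (fi i) x j)"
  have D: "D \<in> Rn d"
    using grad_fi_in_Rn[OF i x] grad_fi_in_Rn[OF i y] by (simp add: D_def Rn_iff)
  have comp: "(\<integral>\<^sup>+m. ennreal (real (nnz d (m i))) \<partial>(\<Pi>\<^sub>M i\<in>{1..n}. message c x y i))
      = (\<integral>\<^sup>+v. ennreal (real (nnz d v)) \<partial>message c x y i)" for c
  proof -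
    have "(\<lambda>v. ennreal (real (nnz d v))) \<in> borel_measurable (message c x y i)"
      using nnz_measurable measurable_cong_sets[OF prob_space_messages(2)[OF x y i, of c] refl]
      by (intro measurable_compose[OF _ measurable_ennreal]) blast
    then show ?thesis
      using i by (subst distr_PiM_component[OF prob_space_messages(1)[OF x y] i, symmetric])
        (auto simp: nn_integral_distr)
  qed
  interpret T: prob_space "message True x y i" by (rule prob_space_messages(1)[OF x y i])
  have "(\<integral>\<^sup>+v. ennreal (real (nnz d v)) \<partial>message True x y i)
      \<le> (\<integral>\<^sup>+v. ennreal (real d) \<partial>message True x y i)"
    by (intro nn_integral_mono ennreal_leI) (simp add: nnz_le)
  then have A: "(\<integral>\<^sup>+v. ennreal (real (nnz d v)) \<partial>message True x y i) \<le> ennreal (real d)"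
    by (simp add: T.emeasure_space_1)
  have "message False x y i = Q D" by (simp add: message_def D_def)
  then have "(\<integral>\<^sup>+v. ennreal (real (nnz d v)) \<partial>message False x y i) = ennreal (\<integral>v. real (nnz d v) \<partial>Q D)"
    using integrable_Q_nnz[OF D] by (simp add: nn_integral_eq_integral)
  then have B: "(\<integral>\<^sup>+v. ennreal (real (nnz d v)) \<partial>message False x y i) \<le> ennreal (expected_density d Q)"
    using nnz_Q_le_expected_density(2)[OF D] by (simp add: ennreal_leI)
  have \<zeta>: "0 \<le> expected_density d Q"
    using nnz_Q_le_expected_density(2)[OF D] by (rule order_trans[rotated]) simp
  note step = nn_integral_marina_step[OF s[unfolded sx] measurable_message_cost[OF i]]
  have "(\<integral>\<^sup>+z. ennreal (real (nnz d (snd (snd z) i))) \<partial>marina_step d n fi Q \<gamma> p s)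
      \<le> ennreal (real d) * ennreal p + ennreal (expected_density d Q) * ennreal (1 - p)"
    unfolding sx step unfolding y_def[symmetric] new_state_def snd_conv comp
    using A B by (intro add_mono mult_right_mono) auto
  also have "\<dots> = ennreal (p * real d + (1 - p) * expected_density d Q)"
    using p \<zeta> by (simp add: ennreal_mult[symmetric] ennreal_plus[symmetric] mult_ac del: ennreal_plus)
  finally show ?thesis .
qed

lemma expected_comm_cost_le:
  assumes x0: "x0 \<in> Rn d" and i: "i \<in> {1..n}"
  shows "expected_comm_cost d n fi Q \<gamma> p x0 K i
    \<le> real d + real K * (p * real d + (1 - p) * expected_density d Q)"
proof -
  let ?c = "p * real d + (1 - p) * expected_density d Q"
  let ?h = "\<lambda>z :: state. real (nnz d (snd (snd z) i))"
  have \<zeta>: "0 \<le> expected_density d Q"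
    using nnz_Q_le_expected_density(2)[OF x0] by (rule order_trans[rotated]) simp
  have prob: "prob_space (marina d n fi Q \<gamma> p x0 k)" for k
    using marina_in_prob_algebra[OF x0, of k] by (simp add: space_prob_algebra)
  have "(\<integral>z. ?h z \<partial>marina d n fi Q \<gamma> p x0 0) \<le> real d"
  proof (rule integral_real_bounded)
    have "(\<integral>\<^sup>+z. ennreal (?h z) \<partial>marina d n fi Q \<gamma> p x0 0) \<le> (\<integral>\<^sup>+z. ennreal (real d) \<partial>marina d n fi Q \<gamma> p x0 0)"
      by (intro nn_integral_mono ennreal_leI) (simp add: nnz_le)
    then show "(\<integral>\<^sup>+z. ennreal (?h z) \<partial>marina d n fi Q \<gamma> p x0 0) \<le> ennreal (real d)"
      by (simp add: prob_space.emeasure_space_1[OF prob] del: marina.simps)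
  qed simp
  moreover have "(\<integral>z. ?h z \<partial>marina d n fi Q \<gamma> p x0 (Suc k)) \<le> ?c" for k
  proof (rule integral_real_bounded)
    have "(\<integral>\<^sup>+z. ennreal (?h z) \<partial>marina d n fi Q \<gamma> p x0 (Suc k)) \<le> (\<integral>\<^sup>+z. ennreal ?c \<partial>marina d n fi Q \<gamma> p x0 k)"
      by (intro nn_integral_marina_Suc_le x0 measurable_message_cost nn_integral_message_cost_step i)
    then show "(\<integral>\<^sup>+z. ennreal (?h z) \<partial>marina d n fi Q \<gamma> p x0 (Suc k)) \<le> ennreal ?c"
      by (simp add: prob_space.emeasure_space_1[OF prob] del: marina.simps)
  qed (use p \<zeta> in simp)
  \<comment> \<open>The cost has \<open>K + 1\<close> summands; the one with index 0 is the initial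
    full gradient, which is bounded by \<open>d\<close> alone.\<close>
  ultimately have "(\<integral>z. ?h z \<partial>marina d n fi Q \<gamma> p x0 0) + (\<Sum>k<K. \<integral>z. ?h z \<partial>marina d n fi Q \<gamma> p x0 (Suc k))
      \<le> real d + (\<Sum>k<K. ?c)"
    by (intro add_mono sum_mono)
  then show ?thesis
    by (simp add: expected_comm_cost_def case_prod_unfold sum.atMost_shift del: marina.simps)
qed

end

section \<open>Complexity\<close>

text \<open>Rules out \<open>L = 0\<close>, where \<open>1 / (L * (1 + \<dots>))\<close> in the stepsize bound is the junk value 0.\<close>

lemma smooth_0_bounded_below_grad:
  assumes sm: "smooth d 0 f" and below: "\<And>y. y \<in> Rn d \<Longrightarrow> b \<le> f y" and x: "x \<in> Rn d"
  shows "enorm d (grad d f x) = 0"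
proof (rule ccontr)
  let ?G = "grad d f x"
  assume "enorm d ?G \<noteq> 0"
  then have pos: "0 < (enorm d ?G)\<^sup>2" by simp
  \<comment> \<open>A gradient step of this length pushes the linear upper bound down to
    \<open>b - 1\<close>, below the lower bound of \<open>f\<close>.\<close>
  define t where "t = (f x - b + 1) / (enorm d ?G)\<^sup>2"
  define y where "y = (\<lambda>j. x j - t * ?G j)"
  have y: "y \<in> Rn d" using x grad_in_Rn[OF sm x] by (simp add: y_def Rn_iff)
  have "f y \<le> f x + (\<Sum>j<d. ?G j * (y j - x j))"
    using smooth_descent[OF sm x y] by simp
  also have "(\<Sum>j<d. ?G j * (y j - x j)) = - t * (enorm d ?G)\<^sup>2"
    unfolding enorm_power2 y_def
    by (simp add: sum_distrib_left sum_negf power2_eq_square mult_ac)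
  also have "\<dots> = - (f x - b + 1)" using pos by (simp add: t_def)
  finally show False using below[OF y] by simp
qed

text \<open>Since \<open>s * t \<le> 1\<close>, squaring \<open>s * t\<close> only decreases it.
  Taken with \<open>t = L * \<gamma>\<close> and \<open>s\<close> the root in the stepsize bound,
  this passes from that bound to the quadratic condition needed for the contraction.\<close>

lemma stepsize_condition:
  fixes s t :: real
  assumes "0 \<le> s" "0 \<le> t" "t * (1 + s) \<le> 1"
  shows "t + s\<^sup>2 * t\<^sup>2 \<le> 1"
proof -
  have "0 \<le> s * t" "s * t \<le> 1" "t + s * t \<le> 1"
    using assms by (simp_all add: algebra_simps add_increasing)
  then have "(s * t)\<^sup>2 \<le> s * t" by (simp add: power2_eq_square mult_left_le)
  then show ?thesis using \<open>t + s * t \<le> 1\<close> by (simp add: power_mult_distrib)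
qed

text \<open>The claim with the explicit constant \<open>4 / \<theta>\<close>. About
  \<open>2 / \<theta>\<close> times the rate and the logarithm suffice as iterations; the other
  factor 2 covers a message cost of up to \<open>2 * \<zeta>\<close>.\<close>

lemma marina_complexity:
  fixes \<theta> :: real
  assumes \<theta>: "0 < \<theta>" "\<theta> \<le> 1" and d: "1 \<le> d" and n: "1 \<le> n"
    and f: "f = (\<lambda>x. average n (\<lambda>i. fi i x))"
    and sm: "\<forall>i\<in>{1..n}. smooth d (Li i) (fi i)"
    and xstar: "is_argmin d f xstar" and \<mu>: "0 < \<mu>" and PL: "polyak_lojasiewicz d \<mu> f xstar"
    and x0: "x0 \<in> Rn d" and L: "L = sqrt (average n (\<lambda>i. (Li i)\<^sup>2))"
    and \<Delta>0: "\<Delta>0 = f x0 - f xstar"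
    and quant: "quantization d \<omega> Q" and \<zeta>: "\<zeta> = expected_density d Q" and p: "p = \<zeta> / real d"
    and stepmax: "stepmax = min (1 / (L * (1 + sqrt (2 * \<omega> / real n * (real d / \<zeta> - 1))))) (p / (2 * \<mu>))"
    and \<gamma>: "\<theta> * stepmax \<le> \<gamma>" "\<gamma> \<le> stepmax" and \<epsilon>: "0 < \<epsilon>" "\<epsilon> \<le> \<Delta>0"
  shows "\<exists>K::nat.
      int K \<le> \<lceil>4 / \<theta> * (max (real d / \<zeta>) (L / \<mu> * (1 + sqrt (\<omega> / real n * (real d / \<zeta> - 1))))
                    * ln (\<Delta>0 / \<epsilon>))\<rceil> \<and>
      integrable (marina d n fi Q \<gamma> p x0 K) (\<lambda>(x, g, m). f x - f xstar) \<and>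
      (\<integral>(x, g, m). f x - f xstar \<partial>marina d n fi Q \<gamma> p x0 K) \<le> \<epsilon> \<and>
      (\<forall>i\<in>{1..n}. expected_comm_cost d n fi Q \<gamma> p x0 K i
         \<le> 4 / \<theta> * (real d + max (real d) (L / \<mu> * (\<zeta> + sqrt (\<omega> * \<zeta> / real n * (real d - \<zeta>))))
                    * ln (\<Delta>0 / \<epsilon>)))"
proof -
  interpret quantizer d \<omega> Q by unfold_locales (rule quant)
  have \<zeta>_pos: "0 < \<zeta>" and \<zeta>_le: "\<zeta> \<le> real d"
    using expected_density_pos[OF d] expected_density_le[OF x0] by (auto simp: \<zeta>)
  have p01: "0 < p" "p \<le> 1" using \<zeta>_pos \<zeta>_le d by (auto simp: p)
  have \<omega>: "0 < \<omega>" using quant by (simp add: quantization_def)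
  interpret M: marina_run d \<omega> Q n fi Li \<gamma> p
    using n sm p01 by unfold_locales auto
  have fF: "f = M.F" by (simp add: f M.F_def[abs_def])
  have LM: "M.L = L" by (simp add: M.L_def L)
  have below: "f xstar \<le> M.F x" if "x \<in> Rn d" for x
    using xstar that by (simp add: is_argmin_def fF)
  have PL': "2 * \<mu> * (M.F x - f xstar) \<le> (enorm d (M.gradF x))\<^sup>2" if "x \<in> Rn d" for x
    using PL M.grad_F that by (simp add: polyak_lojasiewicz_def fF)
  have \<Delta>0_pos: "0 < \<Delta>0" using \<epsilon> by linarith
  have "0 \<le> L" by (simp add: L average_def sum_nonneg)
  \<comment> \<open>For \<open>L = 0\<close> a function bounded below has zero gradient, and the
    Polyak-Lojasiewicz condition would force \<open>\<Delta>0 \<le> 0\<close>.\<close>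
  moreover have "L \<noteq> 0"
  proof
    assume "L = 0"
    then have "enorm d (grad d M.F x0) = 0"
      using M.smooth_F below x0 by (intro smooth_0_bounded_below_grad) (auto simp: LM)
    then show False
      using PL'[OF x0] \<Delta>0_pos \<mu> by (simp add: M.grad_F[OF x0] \<Delta>0 fF mult_le_0_iff)
  qed
  ultimately have L_pos: "0 < L" by simp
  define a where "a = \<omega> / real n * (real d / \<zeta> - 1)"
  define s where "s = sqrt (2 * \<omega> / real n * (real d / \<zeta> - 1))"
  have "1 \<le> real d / \<zeta>" using \<zeta>_pos \<zeta>_le by simp
  then have a0: "0 \<le> a" using \<omega> by (simp add: a_def)
  have s_eq: "s = sqrt 2 * sqrt a"
    by (simp add: s_def a_def real_sqrt_mult[symmetric] del: real_sqrt_mult)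
  have s0: "0 \<le> s" using a0 by (simp add: s_eq)
  have s2: "s\<^sup>2 = 2 * \<omega> * (1 - p) / (p * real n)"
  proof -
    have "s\<^sup>2 = 2 * a" using a0 by (simp add: s_eq power_mult_distrib)
    also have "\<dots> = 2 * \<omega> * (1 - p) / (p * real n)"
      using \<zeta>_pos d n by (simp add: a_def p field_simps)
    finally show ?thesis .
  qed
  \<comment> \<open>The root in the stepsize carries an extra \<open>sqrt 2\<close> compared with
    the root in the complexity bound; this costs at most a factor 2.\<close>
  have "sqrt 2 \<le> (2::real)" by (rule real_le_lsqrt) auto
  then have "s \<le> 2 * sqrt a" unfolding s_eq using a0 by (intro mult_right_mono) auto
  then have s_le: "1 + s \<le> 2 * (1 + sqrt a)" by simp
  have stepmax': "stepmax = min (1 / (L * (1 + s))) (p / (2 * \<mu>))" by (simp add: stepmax s_def)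
  have stepmax_pos: "0 < stepmax" unfolding stepmax' using L_pos s0 p01 \<mu> by simp
  have \<gamma>_pos: "0 < \<gamma>" using stepmax_pos \<theta> \<gamma>(1) by (meson mult_pos_pos less_le_trans)
  have \<gamma>\<mu>: "\<gamma> * \<mu> \<le> p / 2"
  proof -
    have "\<gamma> \<le> p / (2 * \<mu>)" using \<gamma>(2) by (simp add: stepmax')
    then show ?thesis using \<mu> by (simp add: field_simps)
  qed
  have "\<gamma> \<le> 1 / (L * (1 + s))" using \<gamma>(2) by (simp add: stepmax')
  moreover have "0 < L * (1 + s)" using L_pos s0 by simp
  ultimately have "L * \<gamma> * (1 + s) \<le> 1" by (simp only: pos_le_divide_eq mult_ac)
  then have stepsize: "M.L * \<gamma> + 2 * \<omega> * (1 - p) / (p * real n) * (M.L * \<gamma>)\<^sup>2 \<le> 1"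
    unfolding LM s2[symmetric] using s0 L_pos \<gamma>_pos by (intro stepsize_condition) auto
  define R where "R = max (real d / \<zeta>) (L / \<mu> * (1 + sqrt a))"
  have R_pos: "0 < R" unfolding R_def using \<zeta>_pos d by (simp add: less_max_iff_disj)
  \<comment> \<open>Whichever term attains the minimum in \<open>stepmax\<close>, its reciprocal is
    controlled by the matching term of the maximum \<open>R\<close>.\<close>
  have rate: "\<theta> / 2 \<le> \<gamma> * \<mu> * R"
  proof (cases "1 / (L * (1 + s)) \<le> p / (2 * \<mu>)")
    case True
    have "1 + sqrt a \<noteq> 0" using real_sqrt_ge_zero[OF a0] by linarith
    then have "\<theta> / 2 = \<theta> * (1 + sqrt a) / (2 * (1 + sqrt a))"
      by (rule mult_divide_mult_cancel_right[symmetric])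
    also have "\<dots> \<le> \<theta> * (1 + sqrt a) / (1 + s)"
      using s_le s0 \<theta> a0 by (intro divide_left_mono) auto
    also have "\<dots> = (\<theta> * stepmax) * \<mu> * (L / \<mu> * (1 + sqrt a))"
      using True L_pos \<mu> s0 by (simp add: stepmax' min_absorb1)
    also have "\<dots> \<le> \<gamma> * \<mu> * R"
      using \<gamma>(1) \<gamma>_pos \<mu> L_pos a0 by (intro mult_mono) (auto simp: R_def)
    finally show ?thesis .
  next
    case False
    have "\<theta> / 2 = (\<theta> * stepmax) * \<mu> * (real d / \<zeta>)"
      using False \<mu> \<zeta>_pos d by (simp add: stepmax' min_absorb2 p)
    also have "\<dots> \<le> \<gamma> * \<mu> * R"
      using \<gamma>(1) \<gamma>_pos \<mu> \<zeta>_pos by (intro mult_mono) (auto simp: R_def)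
    finally show ?thesis .
  qed
  define l where "l = ln (\<Delta>0 / \<epsilon>)"
  have l0: "0 \<le> l" unfolding l_def using \<epsilon> by simp
  \<comment> \<open>By \<open>rate\<close>, this makes \<open>\<gamma> * \<mu> * K\<close> at least
    \<open>l\<close>, so that \<open>(1 - \<gamma> * \<mu>) ^ K \<le> exp (- l) = \<epsilon> /
    \<Delta>0\<close>.\<close>
  define K where "K = nat \<lceil>2 / \<theta> * (R * l)\<rceil>"
  have Rl0: "0 \<le> 2 / \<theta> * (R * l)" using \<theta> R_pos l0 by simp
  then have "int K = \<lceil>2 / \<theta> * (R * l)\<rceil>" by (simp add: K_def)
  then have K: "2 / \<theta> * (R * l) \<le> real K" "real K \<le> 2 / \<theta> * (R * l) + 1" by linarith+
  have K_le: "int K \<le> \<lceil>4 / \<theta> * (R * l)\<rceil>"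
    unfolding \<open>int K = _\<close> using Rl0 by (intro ceiling_mono) simp
  have decay: "(1 - \<gamma> * \<mu>) ^ K * \<Delta>0 \<le> \<epsilon>"
  proof -
    have "l = 2 / \<theta> * (\<theta> / 2 * l)" using \<theta> by simp
    also have "\<dots> \<le> 2 / \<theta> * (\<gamma> * \<mu> * R * l)"
      using rate \<theta> l0 by (intro mult_left_mono mult_right_mono) auto
    also have "\<dots> = \<gamma> * \<mu> * (2 / \<theta> * (R * l))" by simp
    also have "\<dots> \<le> \<gamma> * \<mu> * real K" using K(1) \<gamma>_pos \<mu> by (intro mult_left_mono) auto
    finally have l_le: "l \<le> \<gamma> * \<mu> * real K" .
    have "(1 - \<gamma> * \<mu>) ^ K \<le> exp (- (\<gamma> * \<mu>)) ^ K"
      using exp_ge_add_one_self[of "- (\<gamma> * \<mu>)"] \<gamma>\<mu> p01 by (intro power_mono) auto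
    also have "\<dots> = exp (- (\<gamma> * \<mu> * real K))"
      by (simp add: exp_of_nat_mult[symmetric] mult_ac)
    also have "\<dots> \<le> exp (- l)" using l_le by simp
    also have "\<dots> = \<epsilon> / \<Delta>0" using \<epsilon> \<Delta>0_pos by (simp add: l_def exp_minus)
    finally show ?thesis using \<Delta>0_pos by (simp add: field_simps)
  qed
  note conv = M.marina_convergence[OF x0 \<mu> \<gamma>_pos \<gamma>\<mu> stepsize below PL', of K]
  have "(\<integral>s. M.F (fst s) - f xstar \<partial>marina d n fi Q \<gamma> p x0 K) \<le> \<epsilon>"
    using conv(2) decay by (simp add: \<Delta>0 fF)
  moreover have "expected_comm_cost d n fi Q \<gamma> p x0 K i
      \<le> 4 / \<theta> * (real d + max (real d) (L / \<mu> * (\<zeta> + sqrt (\<omega> * \<zeta> / real n * (real d - \<zeta>)))) * l)"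
    if i: "i \<in> {1..n}" for i
  proof -
    have "\<zeta> * sqrt a = sqrt (\<zeta>\<^sup>2 * a)" using \<zeta>_pos by (simp add: real_sqrt_mult)
    also have "\<zeta>\<^sup>2 * a = \<omega> * \<zeta> / real n * (real d - \<zeta>)"
      using \<zeta>_pos n by (simp add: a_def field_simps power2_eq_square)
    finally have \<zeta>R: "\<zeta> * R = max (real d) (L / \<mu> * (\<zeta> + sqrt (\<omega> * \<zeta> / real n * (real d - \<zeta>))))"
      unfolding R_def using \<zeta>_pos by (simp add: max_mult_distrib_left algebra_simps)
    have "expected_comm_cost d n fi Q \<gamma> p x0 K i \<le> real d + real K * (p * real d + (1 - p) * \<zeta>)"
      using M.expected_comm_cost_le[OF x0 i] by (simp add: \<zeta>)
    \<comment> \<open>The choice of \<open>p\<close> gives \<open>p * d = \<zeta>\<close>, so both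
      kinds of messages contribute at most \<open>\<zeta>\<close> in expectation.\<close>
    also have "\<dots> \<le> real d + real K * (2 * \<zeta>)"
      using d p01 \<zeta>_pos by (intro add_left_mono mult_left_mono) (auto simp: p algebra_simps)
    also have "\<dots> \<le> real d + (2 / \<theta> * (R * l) + 1) * (2 * \<zeta>)"
      using K(2) \<zeta>_pos by (intro add_left_mono mult_right_mono) auto
    also have "\<dots> = real d + 2 * \<zeta> + 4 / \<theta> * (\<zeta> * R * l)" by (simp add: algebra_simps)
    \<comment> \<open>Rounding \<open>K\<close> up costs \<open>2 * \<zeta> \<le> 2 * d\<close>;
      with the initial \<open>d\<close> this is at most \<open>3 * d\<close>, within the constant
      because \<open>\<theta> \<le> 1\<close>.\<close>
    also have "\<dots> \<le> 4 / \<theta> * real d + 4 / \<theta> * (\<zeta> * R * l)"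
    proof -
      have "4 * real d \<le> 4 / \<theta> * real d"
        using \<theta> by (intro mult_right_mono) (auto simp: field_simps)
      then show ?thesis using \<zeta>_le by simp
    qed
    finally show ?thesis unfolding \<zeta>R by (simp add: algebra_simps)
  qed
  ultimately show ?thesis
    using K_le conv(1) by (auto simp: case_prod_unfold fF R_def a_def l_def intro!: exI[of _ K])
qed

text \<open>The constant \<open>C\<close> is chosen before all problem data and depends on
  \<open>\<theta>\<close> only. The parameter \<open>\<theta>\<close> expresses that the stepsize is
  of the order of its upper bound: an arbitrarily small \<open>\<gamma>\<close> would admit no such
  iteration bound. The condition \<open>\<epsilon> \<le> \<Delta>0\<close> makes the logarithm
  nonnegative, and the ceiling accounts for \<open>K\<close> being an integer.\<close>

theorem corollaryC2:
  fixes \<theta> :: real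
  assumes "0 < \<theta>" and "\<theta> \<le> 1"
  shows "\<exists>C>0. \<forall>(d::nat) (n::nat) (fi :: nat \<Rightarrow> vec \<Rightarrow> real) (Li :: nat \<Rightarrow> real) (f :: vec \<Rightarrow> real)
      (fstar::real) (xstar::vec) (x0::vec) (\<mu>::real) (\<omega>::real) (Q :: vec \<Rightarrow> vec measure)
      (L::real) (\<Delta>0::real) (\<zeta>::real) (p::real) (stepmax::real) (\<gamma>::real) (\<epsilon>::real).
    1 \<le> d \<and> 1 \<le> n \<and>
    f = (\<lambda>x. average n (\<lambda>i. fi i x)) \<and>
    (\<forall>x\<in>Rn d. fstar \<le> f x) \<and>
    (\<forall>i\<in>{1..n}. smooth d (Li i) (fi i)) \<and>
    is_argmin d f xstar \<and> 0 < \<mu> \<and> polyak_lojasiewicz d \<mu> f xstar \<and>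
    x0 \<in> Rn d \<and>
    L = sqrt (average n (\<lambda>i. (Li i)\<^sup>2)) \<and>
    \<Delta>0 = f x0 - f xstar \<and>
    quantization d \<omega> Q \<and> \<zeta> = expected_density d Q \<and> p = \<zeta> / real d \<and>
    stepmax = min (1 / (L * (1 + sqrt (2 * \<omega> / real n * (real d / \<zeta> - 1))))) (p / (2 * \<mu>)) \<and>
    \<theta> * stepmax \<le> \<gamma> \<and> \<gamma> \<le> stepmax \<and>
    0 < \<epsilon> \<and> \<epsilon> \<le> \<Delta>0
    \<longrightarrow>
    (\<exists>K::nat.
      int K \<le> \<lceil>C * (max (real d / \<zeta>) (L / \<mu> * (1 + sqrt (\<omega> / real n * (real d / \<zeta> - 1))))
                    * ln (\<Delta>0 / \<epsilon>))\<rceil> \<and>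
      integrable (marina d n fi Q \<gamma> p x0 K) (\<lambda>(x, g, m). f x - f xstar) \<and>
      (\<integral>(x, g, m). f x - f xstar \<partial>marina d n fi Q \<gamma> p x0 K) \<le> \<epsilon> \<and>
      (\<forall>i\<in>{1..n}. expected_comm_cost d n fi Q \<gamma> p x0 K i
         \<le> C * (real d + max (real d) (L / \<mu> * (\<zeta> + sqrt (\<omega> * \<zeta> / real n * (real d - \<zeta>))))
                    * ln (\<Delta>0 / \<epsilon>))))"
proof (intro exI[of _ "4 / \<theta>"] conjI allI impI)
  show "0 < 4 / \<theta>" using assms(1) by simp
qed (elim conjE, rule marina_complexity[OF assms])

end
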